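(* Let $\omega$ be a non-quasianalytic weight function. Then the following assertions hold true: (i) The multiplication operator $M\colon\mathcal{O}_{M,\omega}(\mathbb{R}^N)\times\mathcal{O}'_{M,\omega}(\mathbb{R}^N)\to\mathcal{O}'_{M,\omega}(\mathbb{R}^N)$, $(f,T)\mapsto fT$, is discontinuous. (ii) The multiplication operator $M\colon\mathcal{O}_{C,\omega}(\mathbb{R}^N)\times\mathcal{O}'_{C,\omega}(\mathbb{R}^N)\to\mathcal{O}'_{C,\omega}(\mathbb{R}^N)$, $(f,T)\mapsto fT$, is discontinuous. (Discontinuous means not jointly continuous for the product topology.)
   Context: Weights. A non-quasianalytic weight function is a continuous increasing function $\omega:[0,\infty)\to[0,\infty)$ such that: ($\alpha$) there is $K\ge 1$ with $\omega(2t)\le K(1+\omega(t))$ for all $t\ge 0$; ($\beta$) $\int_1^\infty \frac{\omega(t)}{1+t^2}\,dt<\infty$; ($\gamma$) there are $a\in\mathbb{R}$, $b>0$ with $\omega(t)\ge a+b\log(1+t)$ for all $t\ge 0$; ($\delta$) $\varphi_\omega(t)=\omega(e^t)$ is convex. It is assumed (normalization) that $\omega$ vanishes on $[0,1]$. For $x\in\mathbb{R}^N$, $\omega(x):=\omega(|x|)$. The Young conjugate is $\varphi^*_\omega(s):=\sup_{t\ge 0}\{st-\varphi_\omega(t)\}$, $s\ge 0$ (the value $+\infty$ is allowed, with $\exp(-\infty)=0$). Spaces. For $m,n\in\mathbb{N}$ let $\mathcal{O}^m_{n,\omega}(\mathbb{R}^N)$ be the space of all $f\in C^\infty(\mathbb{R}^N)$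 with $r_{m,n}(f):=\sup_{\alpha\in\mathbb{N}_0^N}\sup_{x\in\mathbb{R}^N}|\partial^\alpha f(x)|\exp\left(-n\omega(x)-m\varphi^*_\omega\left(\frac{|\alpha|}{m}\right)\right)<\infty$, with norm $r_{m,n}$. Set $\mathcal{O}_{M,\omega}(\mathbb{R}^N):=\bigcap_{m}\bigcup_{n}\mathcal{O}^m_{n,\omega}(\mathbb{R}^N)$ with the topology of the projective limit over $m$ of the locally convex inductive limits $\mathrm{ind}_{n}\,\mathcal{O}^m_{n,\omega}(\mathbb{R}^N)$, and $\mathcal{O}_{C,\omega}(\mathbb{R}^N):=\bigcup_{n}\bigcap_{m}\mathcal{O}^m_{n,\omega}(\mathbb{R}^N)$ with the topology of the locally convex inductive limit over $n$ of the projective limits $\mathrm{proj}_m\,\mathcal{O}^m_{n,\omega}(\mathbb{R}^N)$. A prime denotes the strong dual. For $E=\mathcal{O}_{M,\omega}(\mathbb{R}^N)$ or $E=\mathcal{O}_{C,\omega}(\mathbb{R}^N)$, $f\in E$ and $T\in E'$, $fT\in E'$ is defined by $\langle fT,g\rangle:=\langle T,fg\rangle$, $g\in E$ ($E$ is closed under pointwise multiplication and $g\mapsto fg$ is continuous on $E$). *)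

theory Defs
  imports "HOL-Analysis.Analysis" "HOL-Library.Function_Algebras"
begin

section \<open>Weight functions\<close>

definition nonquasianalytic_weight :: "(real \<Rightarrow> real) \<Rightarrow> bool" where
  "nonquasianalytic_weight \<omega> \<longleftrightarrow>
     continuous_on {0..} \<omega> \<and> mono_on {0..} \<omega> \<and> (\<forall>t\<ge>0. 0 \<le> \<omega> t) \<and>
     (\<exists>K\<ge>1. \<forall>t\<ge>0. \<omega> (2 * t) \<le> K * (1 + \<omega> t)) \<and>
     set_integrable lborel {1..} (\<lambda>t. \<omega> t / (1 + t\<^sup>2)) \<and>
     (\<exists>a b. b > 0 \<and> (\<forall>t\<ge>0. a + b * ln (1 + t) \<le> \<omega> t)) \<and>
     convex_on UNIV (\<lambda>t. \<omega> (exp t)) \<and>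
     (\<forall>t\<in>{0..1}. \<omega> t = 0)"

text \<open>The Young conjugate of \<open>\<phi>(t) = \<omega>(e\<^sup>t)\<close>. It may take the value \<open>\<infinity>\<close>: condition
  \<open>(\<gamma>)\<close> does not say that \<open>ln\<close> is negligible against \<open>\<omega>\<close>.\<close>

definition young_conj :: "(real \<Rightarrow> real) \<Rightarrow> real \<Rightarrow> ereal" where
  "young_conj \<omega> s = (SUP t\<in>{0..}. ereal (s * t - \<omega> (exp t)))"

fun ereal_exp :: "ereal \<Rightarrow> ereal" where
  "ereal_exp (ereal r) = ereal (exp r)"
| "ereal_exp PInfty = \<infinity>"
| "ereal_exp MInfty = 0"

section \<open>Smooth functions and multi-index derivatives\<close>

definition partial_deriv :: "'n::finite \<Rightarrow> (real^'n \<Rightarrow> complex) \<Rightarrow> real^'n \<Rightarrow> complex" where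
  "partial_deriv i f x = vector_derivative (\<lambda>t. f (x + t *\<^sub>R axis i 1)) (at 0)"

text \<open>All iterated partial derivatives, in any order, exist and are continuous.\<close>

definition smooth :: "(real^'n::finite \<Rightarrow> complex) \<Rightarrow> bool" where
  "smooth f \<longleftrightarrow> (\<forall>is. continuous_on UNIV (foldr partial_deriv is f) \<and>
     (\<forall>i x. (\<lambda>t::real. foldr partial_deriv is f (x + t *\<^sub>R axis i 1)) differentiable (at 0)))"

text \<open>An enumeration of the coordinates. Which one does not matter, as the partial
  derivatives of a smooth function commute.\<close>

definition coords :: "'n::finite list" where
  "coords = (SOME is. distinct is \<and> set is = UNIV)"

definition multi_deriv :: "('n::finite \<Rightarrow> nat) \<Rightarrow> (real^'n \<Rightarrow> complex) \<Rightarrow> real^'n \<Rightarrow> complex" where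
  "multi_deriv \<alpha> f = foldr (\<lambda>i. partial_deriv i ^^ \<alpha> i) coords f"

section \<open>Topologies on complex vector spaces of functions\<close>

text \<open>Vector spaces are sets of complex-valued functions with the pointwise operations.\<close>

definition cscale :: "complex \<Rightarrow> ('a \<Rightarrow> complex) \<Rightarrow> 'a \<Rightarrow> complex" where
  "cscale c f = (\<lambda>x. c * f x)"

global_interpretation cfun: vector_space cscale
  defines cfun_subspace = cfun.subspace
  by standard (auto simp: cscale_def fun_eq_iff algebra_simps)

definition seminorm_topology ::
    "('a \<Rightarrow> complex) set \<Rightarrow> (('a \<Rightarrow> complex) \<Rightarrow> real) set \<Rightarrow> ('a \<Rightarrow> complex) topology" where
  "seminorm_topology E P = topology_generated_by
     (insert E {{g \<in> E. p (g - f) < \<epsilon>} | p f \<epsilon>. p \<in> P \<and> f \<in> E \<and> 0 < \<epsilon>})"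

definition convex_set :: "('a \<Rightarrow> complex) set \<Rightarrow> bool" where
  "convex_set C \<longleftrightarrow> (\<forall>f\<in>C. \<forall>g\<in>C. \<forall>t::real. 0 \<le> t \<and> t \<le> 1 \<longrightarrow>
     cscale (of_real (1 - t)) f + cscale (of_real t) g \<in> C)"

text \<open>Locally convex vector space topologies; the carrier is the topspace.\<close>

definition locally_convex :: "('a \<Rightarrow> complex) topology \<Rightarrow> bool" where
  "locally_convex \<tau> \<longleftrightarrow>
     cfun_subspace (topspace \<tau>) \<and>
     continuous_map (prod_topology \<tau> \<tau>) \<tau> (\<lambda>(f, g). f + g) \<and>
     continuous_map (prod_topology euclidean \<tau>) \<tau> (\<lambda>(c, f). cscale c f) \<and>
     (\<forall>U. openin \<tau> U \<and> 0 \<in> U \<longrightarrow>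
        (\<exists>V C. openin \<tau> V \<and> 0 \<in> V \<and> V \<subseteq> C \<and> C \<subseteq> U \<and> convex_set C))"

text \<open>On the intersection of the spaces: the coarsest topology making all inclusions into the
  single spaces continuous.\<close>

definition proj_limit :: "'i set \<Rightarrow> ('i \<Rightarrow> ('a \<Rightarrow> complex) topology) \<Rightarrow> ('a \<Rightarrow> complex) topology" where
  "proj_limit I \<tau> = topology_generated_by
     {(\<Inter>j\<in>I. topspace (\<tau> j)) \<inter> U | i U. i \<in> I \<and> openin (\<tau> i) U}"

text \<open>On the union of the spaces: the finest locally convex topology making all inclusions
  continuous, i.e. the supremum of all locally convex topologies with this property.\<close>

definition ind_limit :: "'i set \<Rightarrow> ('i \<Rightarrow> ('a \<Rightarrow> complex) topology) \<Rightarrow> ('a \<Rightarrow> complex) topology" where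
  "ind_limit I \<tau> = (let E = (\<Union>i\<in>I. topspace (\<tau> i)) in topology_generated_by
     (insert E {U. \<exists>\<sigma>. locally_convex \<sigma> \<and> topspace \<sigma> = E \<and>
        (\<forall>i\<in>I. continuous_map (\<tau> i) \<sigma> (\<lambda>f. f)) \<and> openin \<sigma> U}))"

definition tvs_bounded :: "('a \<Rightarrow> complex) topology \<Rightarrow> ('a \<Rightarrow> complex) set \<Rightarrow> bool" where
  "tvs_bounded \<tau> B \<longleftrightarrow> B \<subseteq> topspace \<tau> \<and>
     (\<forall>U. openin \<tau> U \<and> 0 \<in> U \<longrightarrow> (\<exists>s::real. s > 0 \<and> (\<forall>t>s. B \<subseteq> cscale (of_real t) ` U)))"

text \<open>Functionals are extensional, so that they are determined by their values on the space.\<close>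

definition dual :: "('a \<Rightarrow> complex) topology \<Rightarrow> (('a \<Rightarrow> complex) \<Rightarrow> complex) set" where
  "dual \<tau> = {T \<in> extensional (topspace \<tau>).
     (\<forall>f\<in>topspace \<tau>. \<forall>g\<in>topspace \<tau>. T (f + g) = T f + T g) \<and>
     (\<forall>c. \<forall>f\<in>topspace \<tau>. T (cscale c f) = c * T f) \<and>
     continuous_map \<tau> euclidean T}"

definition strong_dual ::
    "('a \<Rightarrow> complex) topology \<Rightarrow> (('a \<Rightarrow> complex) \<Rightarrow> complex) topology" where
  "strong_dual \<tau> = seminorm_topology (dual \<tau>)
     {(\<lambda>T. SUP g\<in>B. cmod (T g)) | B. tvs_bounded \<tau> B \<and> B \<noteq> {}}"

definition mult_op ::
    "('a \<Rightarrow> complex) topology \<Rightarrow> ('a \<Rightarrow> complex) \<times> (('a \<Rightarrow> complex) \<Rightarrow> complex) \<Rightarrow>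
     ('a \<Rightarrow> complex) \<Rightarrow> complex" where
  "mult_op \<tau> = (\<lambda>(f, T). \<lambda>g\<in>topspace \<tau>. T (f * g))"

text \<open>Some open set has a preimage that is not open. Unlike \<open>\<not> continuous_map X Y h\<close>, this
  cannot hold merely because \<open>h\<close> leaves \<open>topspace Y\<close>.\<close>

definition discontinuous_map :: "'a topology \<Rightarrow> 'b topology \<Rightarrow> ('a \<Rightarrow> 'b) \<Rightarrow> bool" where
  "discontinuous_map X Y h \<longleftrightarrow> (\<exists>U. openin Y U \<and> \<not> openin X {x \<in> topspace X. h x \<in> U})"

lemma discontinuous_map_iff:
  assumes "h \<in> topspace X \<rightarrow> topspace Y"
  shows "discontinuous_map X Y h \<longleftrightarrow> \<not> continuous_map X Y h"
  using assms by (auto simp: discontinuous_map_def continuous_map_def)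

section \<open>The spaces\<close>

definition r_norm :: "(real \<Rightarrow> real) \<Rightarrow> nat \<Rightarrow> nat \<Rightarrow> (real^'n::finite \<Rightarrow> complex) \<Rightarrow> ereal" where
  "r_norm \<omega> m n f = (SUP \<alpha>. SUP x. ereal (cmod (multi_deriv \<alpha> f x)) *
     ereal_exp (- ereal (real n * \<omega> (norm x))
                - ereal (real m) * young_conj \<omega> (real (sum \<alpha> UNIV) / real m)))"

definition O_space :: "(real \<Rightarrow> real) \<Rightarrow> nat \<Rightarrow> nat \<Rightarrow> (real^'n::finite \<Rightarrow> complex) set" where
  "O_space \<omega> m n = {f. smooth f \<and> r_norm \<omega> m n f < \<infinity>}"

definition O_top :: "(real \<Rightarrow> real) \<Rightarrow> nat \<Rightarrow> nat \<Rightarrow> (real^'n::finite \<Rightarrow> complex) topology" where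
  "O_top \<omega> m n = seminorm_topology (O_space \<omega> m n) {\<lambda>f. real_of_ereal (r_norm \<omega> m n f)}"

text \<open>The indices \<open>m\<close>, \<open>n\<close> start at 1, since \<open>m\<close> occurs as a denominator.\<close>

definition O_M :: "(real \<Rightarrow> real) \<Rightarrow> (real^'n::finite \<Rightarrow> complex) topology" where
  "O_M \<omega> = proj_limit {1..} (\<lambda>m. ind_limit {1..} (\<lambda>n. O_top \<omega> m n))"

definition O_C :: "(real \<Rightarrow> real) \<Rightarrow> (real^'n::finite \<Rightarrow> complex) topology" where
  "O_C \<omega> = ind_limit {1..} (\<lambda>n. proj_limit {1..} (\<lambda>m. O_top \<omega> m n))"

lemma topspace_seminorm_topology [simp]: "topspace (seminorm_topology E P) = E"
  by (auto simp: seminorm_topology_def)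

lemma topspace_proj_limit:
  assumes "I \<noteq> {}"
  shows "topspace (proj_limit I \<tau>) = (\<Inter>i\<in>I. topspace (\<tau> i))"
proof
  show "topspace (proj_limit I \<tau>) \<subseteq> (\<Inter>i\<in>I. topspace (\<tau> i))"
    by (auto simp: proj_limit_def)
  obtain i where "i \<in> I" using assms by blast
  then have "(\<Inter>j\<in>I. topspace (\<tau> j)) \<inter> topspace (\<tau> i)
      \<in> {(\<Inter>j\<in>I. topspace (\<tau> j)) \<inter> U | i U. i \<in> I \<and> openin (\<tau> i) U}"
    by blast
  with \<open>i \<in> I\<close> show "(\<Inter>i\<in>I. topspace (\<tau> i)) \<subseteq> topspace (proj_limit I \<tau>)"
    unfolding proj_limit_def topology_generated_by_topspace by blast
qed

lemma topspace_ind_limit: "topspace (ind_limit I \<tau>) = (\<Union>i\<in>I. topspace (\<tau> i))"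
  unfolding ind_limit_def Let_def topology_generated_by_topspace
  using openin_subset by blast

lemma topspace_O_M: "topspace (O_M \<omega>) = (\<Inter>m\<in>{1..}. \<Union>n\<in>{1..}. O_space \<omega> m n)"
  by (simp add: O_M_def O_top_def topspace_proj_limit topspace_ind_limit)

lemma topspace_O_C: "topspace (O_C \<omega>) = (\<Union>n\<in>{1..}. \<Inter>m\<in>{1..}. O_space \<omega> m n)"
  by (simp add: O_C_def O_top_def topspace_proj_limit topspace_ind_limit)

end

theory Submission
  imports Defs
begin

text \<open>Let \<open>E\<close> be one of the two spaces. If the multiplication were continuous at \<open>(0, 0)\<close>, testing
  \<open>fT\<close> on the constant function 1 would give a neighbourhood \<open>V\<close> of 0 in \<open>E\<close>, a bounded set \<open>B\<close>
  and \<open>\<delta> > 0\<close> such that \<open>|T(f)| < 1\<close> whenever \<open>f \<in> V\<close> and \<open>|T| \<le> \<delta>\<close> on \<open>B\<close>. This is refuted by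
  \<open>f(x) = c exp(i e\<^sup>t x\<^sub>i)\<close> and multiples \<open>T\<close> of \<open>g \<mapsto> \<partial>\<^sub>i\<^sup>k g(0)\<close>. For some \<open>m\<close>, the set \<open>V\<close> contains
  these \<open>f\<close> as soon as \<open>|c| exp(m \<omega>(e\<^sup>t))\<close> is small, so the \<open>k\<close>-th derivatives at 0 of the elements
  of \<open>V\<close> reach the order of magnitude \<open>exp(m \<phi>\<^sup>*(k / m))\<close>, uniformly in \<open>k\<close>. On \<open>B\<close> they are bounded
  by a multiple of \<open>exp(m' \<phi>\<^sup>*(k / m'))\<close> for every \<open>m'\<close>, which is of smaller order for large \<open>m'\<close>.\<close>

section \<open>Seminorm topologies and limits\<close>

text \<open>One inequality encodes absolute homogeneity: the reverse one follows by scaling back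
  with \<open>1 / c\<close>. Values of \<open>q\<close> outside \<open>E\<close> are left free, so
  that a supremum that is finite only on \<open>E\<close> qualifies.\<close>

definition seminorm_on :: "('a \<Rightarrow> complex) set \<Rightarrow> (('a \<Rightarrow> complex) \<Rightarrow> real) \<Rightarrow> bool" where
  "seminorm_on E q \<longleftrightarrow> cfun_subspace E \<and> (\<forall>f\<in>E. \<forall>g\<in>E. q (f + g) \<le> q f + q g) \<and>
     (\<forall>c. \<forall>f\<in>E. q (cscale c f) \<le> cmod c * q f)"

lemma cscale_simps [simp]:
  "cscale 0 f = 0" "cscale (-1) f = - f"
  by (auto simp: cscale_def fun_eq_iff)

lemma
  assumes "seminorm_on E q"
  shows seminorm_on_subspace: "cfun_subspace E"
    and seminorm_on_add: "f \<in> E \<Longrightarrow> g \<in> E \<Longrightarrow> q (f + g) \<le> q f + q g"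
    and seminorm_on_scale: "f \<in> E \<Longrightarrow> q (cscale c f) \<le> cmod c * q f"
  using assms by (auto simp: seminorm_on_def)

lemma seminorm_on_zero:
  assumes "seminorm_on E q"
  shows "q 0 = 0"
proof -
  have 0: "0 \<in> E"
    using cfun.subspace_0 seminorm_on_subspace[OF assms] by blast
  \<comment> \<open>Scaling by 0 gives \<open>q 0 \<le> 0\<close>, and \<open>0 = 0 + 0\<close>
    gives the reverse inequality.\<close>
  from seminorm_on_scale[OF assms 0, of 0] seminorm_on_add[OF assms 0 0] show ?thesis
    by simp
qed

lemma seminorm_on_nonneg:
  assumes "seminorm_on E q" "f \<in> E"
  shows "0 \<le> q f"
proof -
  have m: "- f \<in> E"
    using cfun.subspace_neg seminorm_on_subspace assms by blast
  have "q (- f) \<le> q f"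
    using seminorm_on_scale[OF assms, of "-1"] by simp
  with seminorm_on_add[OF assms m] seminorm_on_zero[OF assms(1)] show ?thesis
    by simp
qed

lemma seminorm_on_triangle:
  assumes "seminorm_on E q" "f \<in> E" "g \<in> E" "h \<in> E"
  shows "q (h - f) \<le> q (h - g) + q (g - f)"
proof -
  have "h - g \<in> E" "g - f \<in> E"
    using cfun.subspace_diff[OF seminorm_on_subspace[OF assms(1)]] assms by auto
  from seminorm_on_add[OF assms(1) this] show ?thesis by simp
qed

lemma openin_seminorm_ball:
  assumes "f \<in> E" "0 < \<epsilon>"
  shows "openin (seminorm_topology E {q}) {g \<in> E. q (g - f) < \<epsilon>}"
  unfolding seminorm_topology_def
  by (rule topology_generated_by_Basis) (use assms in auto)

text \<open>The balls enter the definition only as a generating family; for a single seminorm the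
  triangle inequality makes them a base.\<close>

lemma openin_seminorm_topology_iff:
  assumes "seminorm_on E q"
  shows "openin (seminorm_topology E {q}) U \<longleftrightarrow>
    U \<subseteq> E \<and> (\<forall>f\<in>U. \<exists>\<epsilon>>0. \<forall>g\<in>E. q (g - f) < \<epsilon> \<longrightarrow> g \<in> U)"
proof (intro iffI conjI)
  assume "openin (seminorm_topology E {q}) U"
  then show "U \<subseteq> E"
    using openin_subset by fastforce
  from \<open>openin (seminorm_topology E {q}) U\<close>
  have "generate_topology_on
     (insert E {{g \<in> E. p (g - f) < \<epsilon>} | p f \<epsilon>. p \<in> {q} \<and> f \<in> E \<and> 0 < \<epsilon>}) U"
    unfolding seminorm_topology_def openin_topology_generated_by_iff .
  then show "\<forall>f\<in>U. \<exists>\<epsilon>>0. \<forall>g\<in>E. q (g - f) < \<epsilon> \<longrightarrow> g \<in> U"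
  proof induction
    case (Int a b)
    show ?case
    proof
      fix f assume f: "f \<in> a \<inter> b"
      obtain \<epsilon>1 \<epsilon>2 where "\<epsilon>1 > 0" "\<forall>g\<in>E. q (g - f) < \<epsilon>1 \<longrightarrow> g \<in> a"
        "\<epsilon>2 > 0" "\<forall>g\<in>E. q (g - f) < \<epsilon>2 \<longrightarrow> g \<in> b"
        using Int f by blast
      then show "\<exists>\<epsilon>>0. \<forall>g\<in>E. q (g - f) < \<epsilon> \<longrightarrow> g \<in> a \<inter> b"
        by (intro exI[of _ "min \<epsilon>1 \<epsilon>2"]) auto
    qed
  next
    case (UN K)
    then show ?case by (meson Union_iff)
  next
    case (Basis s)
    show ?case
    proof
      fix f assume f: "f \<in> s"
      from Basis consider "s = E" | f0 \<epsilon> where "s = {g \<in> E. q (g - f0) < \<epsilon>}" "f0 \<in> E" "0 < \<epsilon>"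
        by auto
      then show "\<exists>\<epsilon>>0. \<forall>g\<in>E. q (g - f) < \<epsilon> \<longrightarrow> g \<in> s"
      proof cases
        case 1
        then show ?thesis using zero_less_one by blast
      next
        case 2
        \<comment> \<open>The witness is what is left of the radius at \<open>f\<close>.\<close>
        show ?thesis
        proof (intro exI[of _ "\<epsilon> - q (f - f0)"] conjI ballI impI)
          fix g assume g: "g \<in> E" "q (g - f) < \<epsilon> - q (f - f0)"
          then show "g \<in> s"
            using seminorm_on_triangle[OF assms, of f0 f g] 2 f by auto
        qed (use f 2 in auto)
      qed
    qed
  qed auto
next
  assume U: "U \<subseteq> E \<and> (\<forall>f\<in>U. \<exists>\<epsilon>>0. \<forall>g\<in>E. q (g - f) < \<epsilon> \<longrightarrow> g \<in> U)"
  show "openin (seminorm_topology E {q}) U"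
  proof (subst openin_subopen, intro ballI)
    fix f assume f: "f \<in> U"
    with U obtain \<epsilon> where e: "\<epsilon> > 0" "\<forall>g\<in>E. q (g - f) < \<epsilon> \<longrightarrow> g \<in> U" by blast
    with f U seminorm_on_zero[OF assms] openin_seminorm_ball[of f E \<epsilon> q]
    show "\<exists>T. openin (seminorm_topology E {q}) T \<and> f \<in> T \<and> T \<subseteq> U"
      by (intro exI[of _ "{g \<in> E. q (g - f) < \<epsilon>}"]) auto
  qed
qed

text \<open>This makes the topology of \<open>q\<close> a candidate for the supremum that defines
  \<open>ind_limit\<close>.\<close>

lemma locally_convex_seminorm_topology:
  assumes q: "seminorm_on E q"
  shows "locally_convex (seminorm_topology E {q})"
proof -
  note E = seminorm_on_subspace[OF q]
  note iff = openin_seminorm_topology_iff[OF q]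
  let ?\<tau> = "seminorm_topology E {q}"
  have "continuous_map (prod_topology ?\<tau> ?\<tau>) ?\<tau> (\<lambda>(f, g). f + g)"
    unfolding continuous_map_def
  proof (intro conjI allI impI)
    show "(\<lambda>(f, g). f + g) \<in> topspace (prod_topology ?\<tau> ?\<tau>) \<rightarrow> topspace ?\<tau>"
      using cfun.subspace_add[OF E] by auto
    fix U assume U: "openin ?\<tau> U"
    show "openin (prod_topology ?\<tau> ?\<tau>)
        {x \<in> topspace (prod_topology ?\<tau> ?\<tau>). (case x of (f, g) \<Rightarrow> f + g) \<in> U}"
      unfolding openin_prod_topology_alt
    proof (intro allI impI)
      fix f g assume "(f, g) \<in> {x \<in> topspace (prod_topology ?\<tau> ?\<tau>). (case x of (f, g) \<Rightarrow> f + g) \<in> U}"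
      then have fg: "f \<in> E" "g \<in> E" "f + g \<in> U" by auto
      with U obtain \<epsilon> where e: "\<epsilon> > 0" "\<forall>h\<in>E. q (h - (f + g)) < \<epsilon> \<longrightarrow> h \<in> U"
        unfolding iff by blast
      define r where "r = \<epsilon> / 2"
      have r: "r > 0" using e by (simp add: r_def)
      have "h + k \<in> U" if hk: "h \<in> E" "k \<in> E" "q (h - f) < r" "q (k - g) < r" for h k
      proof -
        have "h - f \<in> E" "k - g \<in> E"
          using cfun.subspace_diff[OF E] fg hk by auto
        from seminorm_on_add[OF q this] have "q (h + k - (f + g)) < \<epsilon>"
          using hk by (simp add: algebra_simps r_def)
        then show ?thesis using e hk cfun.subspace_add[OF E] by blast
      qed
      then show "\<exists>V W. openin ?\<tau> V \<and> openin ?\<tau> W \<and> f \<in> V \<and> g \<in> W \<and>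
          V \<times> W \<subseteq> {x \<in> topspace (prod_topology ?\<tau> ?\<tau>). (case x of (f, g) \<Rightarrow> f + g) \<in> U}"
        using fg r seminorm_on_zero[OF q]
        by (intro exI[of _ "{h \<in> E. q (h - f) < r}"] exI[of _ "{h \<in> E. q (h - g) < r}"])
          (auto intro!: openin_seminorm_ball)
    qed
  qed
  moreover have "continuous_map (prod_topology euclidean ?\<tau>) ?\<tau> (\<lambda>(c, f). cscale c f)"
    unfolding continuous_map_def
  proof (intro conjI allI impI)
    show "(\<lambda>(c, f). cscale c f) \<in> topspace (prod_topology euclidean ?\<tau>) \<rightarrow> topspace ?\<tau>"
      using cfun.subspace_scale[OF E] by auto
    fix U assume U: "openin ?\<tau> U"
    show "openin (prod_topology euclidean ?\<tau>)
        {x \<in> topspace (prod_topology euclidean ?\<tau>). (case x of (c, f) \<Rightarrow> cscale c f) \<in> U}"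
      unfolding openin_prod_topology_alt
    proof (intro allI impI)
      fix c f assume "(c, f) \<in> {x \<in> topspace (prod_topology euclidean ?\<tau>). (case x of (c, f) \<Rightarrow> cscale c f) \<in> U}"
      then have f: "f \<in> E" "cscale c f \<in> U" by auto
      with U obtain \<epsilon> where e: "\<epsilon> > 0" "\<forall>h\<in>E. q (h - cscale c f) < \<epsilon> \<longrightarrow> h \<in> U"
        unfolding iff by blast
      have qf: "q f \<ge> 0" using seminorm_on_nonneg[OF q] f by blast
      \<comment> \<open>The error is split below as \<open>d (h - f) + (d - c) f\<close>. The bound
        \<open>r \<le> 1\<close> keeps \<open>cmod d\<close> at most \<open>cmod c + 1\<close>, so
        that \<open>\<rho>\<close> controls the first term by \<open>\<epsilon> / 2\<close>; the
        other bound in \<open>r\<close> does the same for the second, where \<open>1 + q f\<close>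
        avoids a division by 0.\<close>
      define r where "r = min 1 (\<epsilon> / (2 * (1 + q f)))"
      define \<rho> where "\<rho> = \<epsilon> / (2 * (cmod c + 1))"
      have r: "r > 0" "r \<le> 1" "\<rho> > 0"
        using e qf by (auto simp: r_def \<rho>_def add_nonneg_pos)
      have "cscale d h \<in> U" if h: "h \<in> E" "q (h - f) < \<rho>" "dist c d < r" for d h
      proof -
        have hf: "h - f \<in> E" using cfun.subspace_diff[OF E] f h by auto
        have "cscale d h - cscale c f = cscale d (h - f) + cscale (d - c) f"
          by (auto simp: cscale_def fun_eq_iff algebra_simps)
        then have "q (cscale d h - cscale c f) \<le> q (cscale d (h - f)) + q (cscale (d - c) f)"
          using seminorm_on_add[OF q] cfun.subspace_scale[OF E] hf f by metis
        also have "\<dots> \<le> cmod d * q (h - f) + cmod (d - c) * q f"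
          using seminorm_on_scale[OF q] hf f by (intro add_mono) auto
        also have "cmod d * q (h - f) \<le> (cmod c + 1) * q (h - f)"
        proof (rule mult_right_mono)
          have "cmod d \<le> cmod c + dist c d"
            by (metis dist_norm norm_minus_commute norm_triangle_sub)
          then show "cmod d \<le> cmod c + 1" using h r by auto
        qed (use seminorm_on_nonneg[OF q hf] in auto)
        also have "(cmod c + 1) * q (h - f) < (cmod c + 1) * \<rho>"
          using h by (intro mult_strict_left_mono) (auto simp: add_nonneg_pos)
        also have "(cmod c + 1) * \<rho> = \<epsilon> / 2"
          using add_nonneg_pos[of "cmod c" 1] by (simp add: \<rho>_def field_simps)
        also have "cmod (d - c) * q f \<le> r * (1 + q f)"
          using h qf r by (intro mult_mono) (auto simp: dist_norm norm_minus_commute)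
        also have "\<dots> \<le> \<epsilon> / (2 * (1 + q f)) * (1 + q f)"
          using qf by (intro mult_right_mono) (auto simp: r_def)
        also have "\<dots> = \<epsilon> / 2" using qf by (simp add: field_simps)
        finally have "q (cscale d h - cscale c f) < \<epsilon> / 2 + \<epsilon> / 2" by (simp only: add_strict_right_mono)
        then have "q (cscale d h - cscale c f) < \<epsilon>" by (simp only: field_sum_of_halves)
        then show ?thesis using e h cfun.subspace_scale[OF E] by blast
      qed
      then show "\<exists>V W. openin euclidean V \<and> openin ?\<tau> W \<and> c \<in> V \<and> f \<in> W \<and>
          V \<times> W \<subseteq> {x \<in> topspace (prod_topology euclidean ?\<tau>). (case x of (c, f) \<Rightarrow> cscale c f) \<in> U}"
        using f r seminorm_on_zero[OF q]
        by (intro exI[of _ "ball c r"] exI[of _ "{h \<in> E. q (h - f) < \<rho>}"])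
          (auto intro!: openin_seminorm_ball)
    qed
  qed
  moreover have "\<exists>V C. openin ?\<tau> V \<and> 0 \<in> V \<and> V \<subseteq> C \<and> C \<subseteq> U \<and> convex_set C"
    if U: "openin ?\<tau> U" "0 \<in> U" for U
  proof -
    obtain \<epsilon> where e: "\<epsilon> > 0" "\<forall>h\<in>E. q (h - 0) < \<epsilon> \<longrightarrow> h \<in> U"
      using U unfolding iff by blast
    define C where "C = {h \<in> E. q (h - 0) < \<epsilon>}"
    have "convex_set C"
      unfolding convex_set_def
    proof (intro ballI allI impI)
      fix f g and t :: real
      assume fg: "f \<in> C" "g \<in> C" and t: "0 \<le> t \<and> t \<le> 1"
      let ?h = "cscale (of_real (1 - t)) f + cscale (of_real t) g"
      have fE: "cscale a f \<in> E" and gE: "cscale a g \<in> E" for a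
        using cfun.subspace_scale[OF E] fg by (auto simp: C_def)
      have "q ?h \<le> q (cscale (of_real (1 - t)) f) + q (cscale (of_real t) g)"
        using seminorm_on_add[OF q fE gE] .
      also have "\<dots> \<le> cmod (of_real (1 - t)) * q f + cmod (of_real t) * q g"
        using fg by (intro add_mono seminorm_on_scale[OF q]) (auto simp: C_def)
      also have "\<dots> = (1 - t) * q f + t * q g"
        using t by (simp only: norm_of_real) simp
      also have "\<dots> < \<epsilon>"
        using fg t by (intro convex_bound_lt) (auto simp: C_def)
      finally show "?h \<in> C"
        using cfun.subspace_add[OF E fE gE] by (simp add: C_def)
    qed
    moreover have "openin ?\<tau> C"
      unfolding C_def using e(1) cfun.subspace_0[OF E] by (intro openin_seminorm_ball)
    moreover have "0 \<in> C"
      using e(1) cfun.subspace_0[OF E] seminorm_on_zero[OF q] by (simp add: C_def)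
    ultimately show ?thesis using e by (intro exI[of _ C]) (auto simp: C_def)
  qed
  ultimately show ?thesis
    using E by (simp add: locally_convex_def)
qed

text \<open>\<open>q\<close> is the supremum of \<open>cmod (L z f)\<close> over \<open>z\<close>,
  characterised by its upper bounds. The case \<open>C = q f\<close> contains the boundedness of the
  family, which is where finiteness of the norms on \<open>E\<close> enters.\<close>

lemma seminorm_on_sup:
  assumes E: "cfun_subspace E"
    and le: "\<And>f C. f \<in> E \<Longrightarrow> q f \<le> C \<longleftrightarrow> (\<forall>z. cmod (L z f) \<le> C)"
    and add: "\<And>z f g. f \<in> E \<Longrightarrow> g \<in> E \<Longrightarrow> L z (f + g) = L z f + L z g"
    and scale: "\<And>z c f. f \<in> E \<Longrightarrow> L z (cscale c f) = c * L z f"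
  shows "seminorm_on E q"
proof -
  have L: "cmod (L z f) \<le> q f" if "f \<in> E" for z f
    using le[OF that, of "q f"] by simp
  have "q (f + g) \<le> q f + q g" if "f \<in> E" "g \<in> E" for f g
    unfolding le[OF cfun.subspace_add[OF E that]] add[OF that]
    using L[OF that(1)] L[OF that(2)] by (meson add_mono norm_triangle_le)
  moreover have "q (cscale c f) \<le> cmod c * q f" if "f \<in> E" for c f
    unfolding le[OF cfun.subspace_scale[OF E that]] scale[OF that] norm_mult
    using L[OF that] by (simp add: mult_left_mono)
  ultimately show ?thesis using E by (simp add: seminorm_on_def)
qed

section \<open>Continuity of seminorms on projective and inductive limits\<close>

definition seminorm_continuous ::
    "('a \<Rightarrow> complex) topology \<Rightarrow> (('a \<Rightarrow> complex) \<Rightarrow> real) \<Rightarrow> bool" where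
  "seminorm_continuous \<tau> q \<longleftrightarrow>
     (\<forall>f\<in>topspace \<tau>. \<forall>\<epsilon>>0. openin \<tau> {g \<in> topspace \<tau>. q (g - f) < \<epsilon>})"

lemma seminorm_continuous_proj_limit:
  assumes "i \<in> I" "seminorm_continuous (\<tau> i) q"
  shows "seminorm_continuous (proj_limit I \<tau>) q"
  unfolding seminorm_continuous_def
proof (intro ballI allI impI)
  fix f and \<epsilon> :: real
  have I: "I \<noteq> {}" using assms by blast
  assume f: "f \<in> topspace (proj_limit I \<tau>)" and e: "\<epsilon> > 0"
  let ?U = "{g \<in> topspace (\<tau> i). q (g - f) < \<epsilon>}"
  have "f \<in> topspace (\<tau> i)" using f assms by (simp add: topspace_proj_limit[OF I])
  then have "openin (\<tau> i) ?U" using assms(2) e by (auto simp: seminorm_continuous_def)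
  then have "openin (proj_limit I \<tau>) ((\<Inter>j\<in>I. topspace (\<tau> j)) \<inter> ?U)"
    unfolding proj_limit_def using assms(1) by (intro topology_generated_by_Basis) blast
  also have "(\<Inter>j\<in>I. topspace (\<tau> j)) \<inter> ?U
      = {g \<in> topspace (proj_limit I \<tau>). q (g - f) < \<epsilon>}"
    using assms(1) by (auto simp: topspace_proj_limit[OF I])
  finally show "openin (proj_limit I \<tau>) {g \<in> topspace (proj_limit I \<tau>). q (g - f) < \<epsilon>}" .
qed

text \<open>The topology of \<open>q\<close> on the union is locally convex, and the inclusion of
  each step is continuous for it because \<open>q\<close> is continuous on the step. It is therefore
  among the \<open>\<sigma>\<close> in the definition of \<open>ind_limit\<close>, and its balls are
  open there.\<close>

lemma seminorm_continuous_ind_limit: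
  assumes "\<And>i. i \<in> I \<Longrightarrow> seminorm_continuous (\<tau> i) q"
    and q: "seminorm_on (\<Union>i\<in>I. topspace (\<tau> i)) q"
  shows "seminorm_continuous (ind_limit I \<tau>) q"
proof -
  let ?E = "\<Union>i\<in>I. topspace (\<tau> i)"
  let ?\<sigma> = "seminorm_topology ?E {q}"
  have cont: "continuous_map (\<tau> i) ?\<sigma> (\<lambda>f. f)" if i: "i \<in> I" for i
    unfolding continuous_map_def
  proof (intro conjI allI impI)
    show "(\<lambda>f. f) \<in> topspace (\<tau> i) \<rightarrow> topspace ?\<sigma>" using i by auto
    fix U assume U: "openin ?\<sigma> U"
    show "openin (\<tau> i) {f \<in> topspace (\<tau> i). f \<in> U}"
    proof (subst openin_subopen, intro ballI)
      fix f assume f: "f \<in> {f \<in> topspace (\<tau> i). f \<in> U}"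
      with U obtain \<epsilon> where e: "\<epsilon> > 0" "\<forall>h\<in>?E. q (h - f) < \<epsilon> \<longrightarrow> h \<in> U"
        unfolding openin_seminorm_topology_iff[OF q] by blast
      with f assms(1)[OF i] seminorm_on_zero[OF q] i
      show "\<exists>T. openin (\<tau> i) T \<and> f \<in> T \<and> T \<subseteq> {f \<in> topspace (\<tau> i). f \<in> U}"
        by (intro exI[of _ "{g \<in> topspace (\<tau> i). q (g - f) < \<epsilon>}"])
          (auto simp: seminorm_continuous_def)
    qed
  qed
  have "openin (ind_limit I \<tau>) U" if "openin ?\<sigma> U" for U
    unfolding ind_limit_def Let_def
    by (rule topology_generated_by_Basis)
      (use that cont locally_convex_seminorm_topology[OF q] in \<open>auto intro!: exI[of _ ?\<sigma>]\<close>)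
  then show ?thesis
    unfolding seminorm_continuous_def topspace_ind_limit
    by (blast intro: openin_seminorm_ball)
qed

lemma continuous_map_into_ind_limit:
  assumes "i \<in> I"
  shows "continuous_map (\<tau> i) (ind_limit I \<tau>) (\<lambda>f. f)"
  unfolding ind_limit_def Let_def
proof (rule continuous_on_generated_topo)
  fix U assume "U \<in> insert (\<Union>i\<in>I. topspace (\<tau> i)) {U. \<exists>\<sigma>. locally_convex \<sigma> \<and>
      topspace \<sigma> = (\<Union>i\<in>I. topspace (\<tau> i)) \<and>
      (\<forall>i\<in>I. continuous_map (\<tau> i) \<sigma> (\<lambda>f. f)) \<and> openin \<sigma> U}"
  then consider "U = (\<Union>i\<in>I. topspace (\<tau> i))" |
    \<sigma> where "continuous_map (\<tau> i) \<sigma> (\<lambda>f. f)" "openin \<sigma> U" using assms by auto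
  then show "openin (\<tau> i) ((\<lambda>f. f) -` U \<inter> topspace (\<tau> i))"
  proof cases
    case 1
    then have "(\<lambda>f. f) -` U \<inter> topspace (\<tau> i) = topspace (\<tau> i)" using assms by auto
    then show ?thesis by (metis openin_topspace)
  next
    case 2
    then have "openin (\<tau> i) {f \<in> topspace (\<tau> i). f \<in> U}"
      by (auto simp: continuous_map_def)
    also have "{f \<in> topspace (\<tau> i). f \<in> U} = (\<lambda>f. f) -` U \<inter> topspace (\<tau> i)" by auto
    finally show ?thesis .
  qed
qed (use assms in auto)

section \<open>The strong dual\<close>

lemma tvs_bounded_Un:
  assumes "tvs_bounded \<tau> A" "tvs_bounded \<tau> B"
  shows "tvs_bounded \<tau> (A \<union> B)"
  unfolding tvs_bounded_def
proof (intro conjI allI impI)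
  show "A \<union> B \<subseteq> topspace \<tau>" using assms by (auto simp: tvs_bounded_def)
  fix U assume "openin \<tau> U \<and> 0 \<in> U"
  with assms obtain s t where "s > 0" "\<forall>r>s. A \<subseteq> cscale (of_real r) ` U"
     "t > 0" "\<forall>r>t. B \<subseteq> cscale (of_real r) ` U"
    unfolding tvs_bounded_def by metis
  then show "\<exists>s>0. \<forall>t>s. A \<union> B \<subseteq> cscale (of_real t) ` U"
    by (intro exI[of _ "max s t"]) auto
qed

lemma tvs_bounded_seminorm:
  assumes B: "tvs_bounded \<tau> B" and q: "seminorm_on F q" "topspace \<tau> \<subseteq> F"
    and cont: "seminorm_continuous \<tau> q" and 0: "0 \<in> topspace \<tau>"
  shows "\<exists>C>0. \<forall>g\<in>B. q g \<le> C"
proof -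
  let ?U = "{g \<in> topspace \<tau>. q (g - 0) < 1}"
  have "openin \<tau> ?U" using cont 0 zero_less_one unfolding seminorm_continuous_def by blast
  moreover have "0 \<in> ?U" using 0 seminorm_on_zero[OF q(1)] by simp
  ultimately obtain s where s: "s > 0" "\<forall>t>s. B \<subseteq> cscale (of_real t) ` ?U"
    using B unfolding tvs_bounded_def by blast
  have "q g \<le> s + 1" if "g \<in> B" for g
  proof -
    \<comment> \<open>Absorption is known only for factors strictly above \<open>s\<close>, hence
      \<open>s + 1\<close>.\<close>
    have "B \<subseteq> cscale (of_real (s + 1)) ` ?U"
      using s(2) less_add_one by blast
    then obtain u where u: "g = cscale (of_real (s + 1)) u" "u \<in> topspace \<tau>" "q (u - 0) < 1"
      using \<open>g \<in> B\<close> by blast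
    have "q g \<le> cmod (of_real (s + 1)) * q u"
      unfolding u using seminorm_on_scale[OF q(1)] q(2) u by blast
    also have "\<dots> = (s + 1) * q u" using s by (simp only: norm_of_real)
    also have "\<dots> \<le> (s + 1) * 1" using s u by (intro mult_left_mono) auto
    finally show ?thesis by simp
  qed
  then show ?thesis using s by (intro exI[of _ "s + 1"]) auto
qed

text \<open>The seminorms of the strong dual are real suprema, which are informative only for
  bounded families. Continuity of \<open>T\<close> supplies a neighbourhood of 0 on which
  \<open>cmod (T u) < 1\<close>, and this neighbourhood absorbs \<open>B\<close>.\<close>

lemma dual_bdd_above:
  assumes T: "T \<in> dual \<tau>" and B: "tvs_bounded \<tau> B" and 0: "0 \<in> topspace \<tau>"
  shows "bdd_above ((\<lambda>g. cmod (T g)) ` B)"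
proof -
  have T0: "T 0 = 0"
  proof -
    have "T (cscale 0 0) = 0 * T 0" using T 0 unfolding dual_def by blast
    then show ?thesis by simp
  qed
  let ?U = "{g \<in> topspace \<tau>. T g \<in> ball 0 1}"
  have "openin \<tau> ?U"
    using T openin_continuous_map_preimage[of \<tau> euclidean T "ball 0 1"] by (simp add: dual_def)
  moreover have "0 \<in> ?U" using 0 T0 by simp
  ultimately obtain s where s: "s > 0" "\<forall>t>s. B \<subseteq> cscale (of_real t) ` ?U"
    using B unfolding tvs_bounded_def by blast
  show ?thesis
  proof (rule bdd_aboveI2)
    fix g assume "g \<in> B"
    moreover have "B \<subseteq> cscale (of_real (s + 1)) ` ?U"
      using s(2) less_add_one by blast
    ultimately obtain u where u: "g = cscale (of_real (s + 1)) u" "u \<in> topspace \<tau>" "cmod (T u) < 1"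
      by auto
    then have "T g = of_real (s + 1) * T u" using T unfolding dual_def by blast
    then have "cmod (T g) = (s + 1) * cmod (T u)"
      using s by (simp only: norm_mult norm_of_real)
    also have "\<dots> \<le> (s + 1) * 1" using s u by (intro mult_left_mono) auto
    finally show "cmod (T g) \<le> (s + 1) * 1" .
  qed
qed

lemma zero_in_dual:
  assumes "cfun_subspace (topspace \<tau>)"
  shows "(\<lambda>g\<in>topspace \<tau>. 0) \<in> dual \<tau>"
  using cfun.subspace_add[OF assms] cfun.subspace_scale[OF assms]
  by (auto simp: dual_def intro: continuous_map_eq[of _ _ "\<lambda>_. 0"])

text \<open>One bounded set and one bound suffice although the generating balls have arbitrary
  centres: intersections are handled by \<open>A \<union> B\<close> and a minimum, and a ball around
  \<open>T0\<close> that contains zero leaves room around zero for the same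
  \<open>B\<close>.\<close>

lemma strong_dual_nhd_zero:
  assumes W: "openin (strong_dual \<tau>) W" "(\<lambda>g\<in>topspace \<tau>. 0) \<in> W" and 0: "0 \<in> topspace \<tau>"
  shows "\<exists>B \<delta>. tvs_bounded \<tau> B \<and> \<delta> > 0 \<and> (\<forall>T\<in>dual \<tau>. (\<forall>g\<in>B. cmod (T g) \<le> \<delta>) \<longrightarrow> T \<in> W)"
proof -
  let ?P = "{(\<lambda>T. SUP g\<in>B. cmod (T g)) | B. tvs_bounded \<tau> B \<and> B \<noteq> {}}"
  have "generate_topology_on
     (insert (dual \<tau>) {{g \<in> dual \<tau>. p (g - f) < \<epsilon>} | p f \<epsilon>. p \<in> ?P \<and> f \<in> dual \<tau> \<and> 0 < \<epsilon>}) W"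
    using W(1) unfolding strong_dual_def seminorm_topology_def openin_topology_generated_by_iff .
  then show ?thesis using W(2)
  proof induction
    case (Int a b)
    then obtain A \<delta>1 B \<delta>2 where
      A: "tvs_bounded \<tau> A" "\<delta>1 > 0" "\<forall>T\<in>dual \<tau>. (\<forall>g\<in>A. cmod (T g) \<le> \<delta>1) \<longrightarrow> T \<in> a" and
      B: "tvs_bounded \<tau> B" "\<delta>2 > 0" "\<forall>T\<in>dual \<tau>. (\<forall>g\<in>B. cmod (T g) \<le> \<delta>2) \<longrightarrow> T \<in> b"
      by blast
    then show ?case
      by (intro exI[of _ "A \<union> B"] exI[of _ "min \<delta>1 \<delta>2"]) (auto simp: tvs_bounded_Un)
  next
    case (UN K)
    then show ?case by (meson Union_iff)
  next
    case (Basis s)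
    then consider "s = dual \<tau>" |
      B T0 \<epsilon> where "s = {g \<in> dual \<tau>. (SUP h\<in>B. cmod ((g - T0) h)) < \<epsilon>}" "T0 \<in> dual \<tau>" "0 < \<epsilon>"
        "tvs_bounded \<tau> B" "B \<noteq> {}" by blast
    then show ?case
    proof cases
      case 1
      \<comment> \<open>The whole dual imposes no condition, which is expressed by the empty bounded
        set.\<close>
      have "tvs_bounded \<tau> {}" by (auto simp: tvs_bounded_def intro: exI[of _ 1])
      with 1 show ?thesis by (intro exI[of _ "{}"] exI[of _ 1]) auto
    next
      case 2
      have BE: "B \<subseteq> topspace \<tau>" using 2 by (auto simp: tvs_bounded_def)
      define \<rho> where "\<rho> = (SUP h\<in>B. cmod (T0 h))"
      \<comment> \<open>On \<open>B\<close> the restricted zero functional vanishes, so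
        \<open>\<rho>\<close> is its distance from \<open>T0\<close>; it lies below
        \<open>\<epsilon>\<close> as zero belongs to the ball.\<close>
      have "\<rho> = (SUP h\<in>B. cmod (((\<lambda>g\<in>topspace \<tau>. 0) - T0) h))"
        unfolding \<rho>_def using BE by (intro SUP_cong refl) (auto simp: subset_iff)
      with 2 Basis have r: "\<rho> < \<epsilon>" by simp
      have T0: "cmod (T0 h) \<le> \<rho>" if "h \<in> B" for h
        unfolding \<rho>_def using dual_bdd_above[OF 2(2,4) 0] that by (intro cSUP_upper) auto
      \<comment> \<open>Half of the gap is taken because a pointwise bound passes to the supremum
        only as a weak inequality, while the ball requires a strict one.\<close>
      have "T \<in> s" if T: "T \<in> dual \<tau>" "\<forall>g\<in>B. cmod (T g) \<le> (\<epsilon> - \<rho>) / 2" for T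
      proof -
        have "(SUP h\<in>B. cmod ((T - T0) h)) \<le> (\<epsilon> - \<rho>) / 2 + \<rho>"
        proof (rule cSUP_least)
          fix h assume "h \<in> B"
          then have "cmod (T h) \<le> (\<epsilon> - \<rho>) / 2" "cmod (T0 h) \<le> \<rho>" using T T0 by auto
          then show "cmod ((T - T0) h) \<le> (\<epsilon> - \<rho>) / 2 + \<rho>"
            using norm_triangle_ineq4[of "T h" "T0 h"] by (simp add: field_simps)
        qed (use 2 in auto)
        also have "\<dots> < \<epsilon>" using r by (simp add: field_simps)
        finally show ?thesis using T 2 by simp
      qed
      then show ?thesis using 2 r by (intro exI[of _ B] exI[of _ "(\<epsilon> - \<rho>) / 2"]) auto
    qed
  qed auto
qed

section \<open>Derivatives\<close>

lemma partial_deriv_eqI: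
  "((\<lambda>t. f (x + t *\<^sub>R axis i 1)) has_vector_derivative d) (at 0) \<Longrightarrow> partial_deriv i f x = d"
  unfolding partial_deriv_def by (rule vector_derivative_at)

lemma smooth_has_partial_deriv:
  assumes "smooth f"
  shows "((\<lambda>t. foldr partial_deriv js f (x + t *\<^sub>R axis i 1)) has_vector_derivative
      partial_deriv i (foldr partial_deriv js f) x) (at 0)"
proof -
  have "(\<lambda>t. foldr partial_deriv js f (x + t *\<^sub>R axis i 1)) differentiable (at 0)"
    using assms unfolding smooth_def by blast
  then show ?thesis
    by (simp only: vector_derivative_works partial_deriv_def[of i])
qed

lemma foldr_partial_deriv_add:
  assumes "smooth f" "smooth g"
  shows "foldr partial_deriv is (f + g) = foldr partial_deriv is f + foldr partial_deriv is g"
proof (induction "is")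
  case (Cons i js)
  have "partial_deriv i (foldr partial_deriv js f + foldr partial_deriv js g)
      = partial_deriv i (foldr partial_deriv js f) + partial_deriv i (foldr partial_deriv js g)"
    using has_vector_derivative_add[OF smooth_has_partial_deriv[OF assms(1), of js _ i]
        smooth_has_partial_deriv[OF assms(2), of js _ i]]
    by (intro ext partial_deriv_eqI) simp
  then show ?case by (simp only: foldr.simps comp_apply Cons.IH)
qed simp

lemma foldr_partial_deriv_cscale:
  assumes "smooth f"
  shows "foldr partial_deriv is (cscale c f) = cscale c (foldr partial_deriv is f)"
proof (induction "is")
  case (Cons i js)
  have "partial_deriv i (cscale c (foldr partial_deriv js f))
      = cscale c (partial_deriv i (foldr partial_deriv js f))"
    using has_vector_derivative_mult_right[OF smooth_has_partial_deriv[OF assms, of js _ i], of c]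
    by (intro ext partial_deriv_eqI) (simp add: cscale_def)
  then show ?case by (simp only: foldr.simps comp_apply Cons.IH)
qed simp

lemma smooth_add:
  assumes "smooth f" "smooth g"
  shows "smooth (f + g)"
  using assms unfolding smooth_def[of "f + g"] foldr_partial_deriv_add[OF assms]
  by (auto simp: smooth_def plus_fun_def intro: continuous_on_add)

lemma smooth_cscale:
  assumes "smooth f"
  shows "smooth (cscale c f)"
  using assms unfolding smooth_def[of "cscale c f"] foldr_partial_deriv_cscale[OF assms]
  by (auto simp: smooth_def cscale_def intro: continuous_on_mult_left)

text \<open>\<open>smooth\<close> speaks of lists of directions; flattening a multi-index to such a
  list makes the rules on \<open>foldr partial_deriv\<close> apply to
  \<open>multi_deriv\<close>.\<close>

definition multi_index_list :: "('n::finite \<Rightarrow> nat) \<Rightarrow> 'n list" where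
  "multi_index_list \<alpha> = concat (map (\<lambda>i. replicate (\<alpha> i) i) coords)"

lemma coords: "distinct (coords :: 'n::finite list)" "set (coords :: 'n list) = UNIV"
proof -
  have "\<exists>is :: 'n list. distinct is \<and> set is = UNIV"
    using finite_distinct_list[OF finite] by blast
  then have "distinct (coords :: 'n list) \<and> set (coords :: 'n list) = UNIV"
    unfolding coords_def by (rule someI_ex)
  then show "distinct (coords :: 'n::finite list)" "set (coords :: 'n list) = UNIV" by auto
qed

lemma length_multi_index_list: "length (multi_index_list \<alpha>) = sum \<alpha> UNIV"
  unfolding multi_index_list_def
  using sum_list_distinct_conv_sum_set[OF coords(1), of \<alpha>]
  by (simp add: length_concat coords comp_def)

lemma set_multi_index_list: "set (multi_index_list \<alpha>) = {i. \<alpha> i \<noteq> 0}"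
  by (auto simp: multi_index_list_def coords)

lemma multi_deriv_conv_foldr: "multi_deriv \<alpha> f = foldr partial_deriv (multi_index_list \<alpha>) f"
proof -
  have rep: "foldr partial_deriv (replicate k i) h = (partial_deriv i ^^ k) h" for k i h
    by (induction k) auto
  have "foldr (\<lambda>i. partial_deriv i ^^ \<alpha> i) cs f
      = foldr partial_deriv (concat (map (\<lambda>i. replicate (\<alpha> i) i) cs)) f" for cs
    by (induction cs) (auto simp: rep)
  then show ?thesis by (simp add: multi_deriv_def multi_index_list_def)
qed

lemma multi_deriv_add:
  "smooth f \<Longrightarrow> smooth g \<Longrightarrow> multi_deriv \<alpha> (f + g) x = multi_deriv \<alpha> f x + multi_deriv \<alpha> g x"
  unfolding multi_deriv_conv_foldr by (subst foldr_partial_deriv_add) auto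

lemma multi_deriv_cscale:
  "smooth f \<Longrightarrow> multi_deriv \<alpha> (cscale c f) x = c * multi_deriv \<alpha> f x"
  unfolding multi_deriv_conv_foldr by (subst foldr_partial_deriv_cscale) (auto simp: cscale_def)

section \<open>Plane waves and their derivatives\<close>

definition wave :: "'n::finite \<Rightarrow> complex \<Rightarrow> real \<Rightarrow> real^'n \<Rightarrow> complex" where
  "wave i c s x = c * exp (\<i> * of_real (s * x $ i))"

lemma has_vector_derivative_wave:
  "((\<lambda>t. wave i c s (x + t *\<^sub>R axis j 1)) has_vector_derivative
    wave i (c * (if j = i then \<i> * of_real s else 0)) s (x + t *\<^sub>R axis j 1)) (at t)"
proof (cases "j = i")
  case True
  have "((\<lambda>t. c * exp (\<i> * of_real (s * (x $ i + t)))) has_vector_derivative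
      c * (\<i> * of_real s) * exp (\<i> * of_real (s * (x $ i + t)))) (at t)"
    unfolding of_real_mult of_real_add
    by (rule has_vector_derivative_real_field) (auto intro!: derivative_eq_intros simp: algebra_simps)
  then show ?thesis using True by (simp add: wave_def axis_def)
qed (simp add: wave_def axis_def)

text \<open>A derivative changes only the amplitude, so the waves with fixed \<open>i\<close> and
  \<open>s\<close> are closed under differentiation; this settles smoothness and all derivatives at
  once.\<close>

lemma foldr_partial_deriv_wave:
  "foldr partial_deriv is (wave i c s)
    = wave i (c * (\<Prod>j\<leftarrow>is. if j = i then \<i> * of_real s else 0)) s"
proof (induction "is")
  case (Cons j js)
  have "partial_deriv j (wave i d s) = wave i (d * (if j = i then \<i> * of_real s else 0)) s" for d
  proof (rule ext, rule partial_deriv_eqI)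
    fix x
    show "((\<lambda>t. wave i d s (x + t *\<^sub>R axis j 1)) has_vector_derivative
        wave i (d * (if j = i then \<i> * of_real s else 0)) s x) (at 0)"
      using has_vector_derivative_wave[of i d s x j 0] by simp
  qed
  then show ?case by (simp add: Cons.IH mult_ac)
qed simp

lemma smooth_wave: "smooth (wave i c s)"
proof -
  have "continuous_on UNIV (wave i c s)" for c
    unfolding wave_def by (intro continuous_intros)
  then show ?thesis
    unfolding smooth_def foldr_partial_deriv_wave
    using differentiableI_vector[OF has_vector_derivative_wave] by blast
qed

text \<open>Bounding the frequency by \<open>exp t\<close> rather than fixing it includes constants
  (\<open>s = 0\<close>). The parameter \<open>t\<close> will be the variable of the Young
  conjugate.\<close>

lemma cmod_multi_deriv_wave_le:
  assumes "\<bar>s\<bar> \<le> exp t" "0 \<le> t"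
  shows "cmod (multi_deriv \<alpha> (wave i c s) x) \<le> cmod c * exp (real (sum \<alpha> UNIV) * t)"
proof -
  have "cmod (\<Prod>j\<leftarrow>js. if j = i then \<i> * of_real s else 0) \<le> exp (real (length js) * t)" for js
  proof (induction js)
    case (Cons j js)
    have "cmod (if j = i then \<i> * of_real s else 0) \<le> exp t" using assms by (auto simp: norm_mult)
    from mult_mono[OF this Cons.IH] show ?case
      by (simp add: norm_mult algebra_simps exp_add)
  qed simp
  from mult_left_mono[OF this[of "multi_index_list \<alpha>"], of "cmod c"] show ?thesis
    unfolding multi_deriv_conv_foldr foldr_partial_deriv_wave wave_def
    by (simp add: norm_mult length_multi_index_list)
qed

text \<open>No factor of the product vanishes for this multi-index, so the preceding upper bound is
  attained, and this at every point.\<close>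

lemma cmod_multi_deriv_wave_eq:
  "cmod (multi_deriv ((\<lambda>_. 0)(i := k)) (wave i c (exp t)) x) = cmod c * exp (real k * t)"
proof -
  let ?\<alpha> = "(\<lambda>_. 0)(i := k)"
  have "cmod (\<Prod>j\<leftarrow>js. if j = i then \<i> * of_real (exp t) else 0) = exp (real (length js) * t)"
    if "set js \<subseteq> {i}" for js
    using that by (induction js) (auto simp: norm_mult algebra_simps exp_add)
  moreover have "set (multi_index_list ?\<alpha>) \<subseteq> {i}" by (auto simp: set_multi_index_list)
  ultimately show ?thesis
    unfolding multi_deriv_conv_foldr foldr_partial_deriv_wave wave_def
    by (simp add: norm_mult length_multi_index_list del: of_real_exp)
qed

section \<open>The defining norms\<close>

locale weight =
  fixes \<omega> :: "real \<Rightarrow> real"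
  assumes weight: "nonquasianalytic_weight \<omega>"
begin

lemma weight_nonneg: "0 \<le> t \<Longrightarrow> 0 \<le> \<omega> t"
  and weight_vanish: "0 \<le> t \<Longrightarrow> t \<le> 1 \<Longrightarrow> \<omega> t = 0"
  and weight_double: "\<exists>K\<ge>1. \<forall>t\<ge>0. \<omega> (2 * t) \<le> K * (1 + \<omega> t)"
  and weight_log: "\<exists>a b. b > 0 \<and> (\<forall>t\<ge>0. a + b * ln (1 + t) \<le> \<omega> t)"
  using weight unfolding nonquasianalytic_weight_def by auto

section \<open>The Young conjugate and the weight factor\<close>

lemma young_conj_nonneg: "0 \<le> young_conj \<omega> s"
proof -
  \<comment> \<open>The choice \<open>t = 0\<close> contributes \<open>- \<omega> 1\<close>, which
    is 0. This excludes the value minus infinity.\<close>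
  have "ereal (s * 0 - \<omega> (exp 0)) \<le> young_conj \<omega> s"
    unfolding young_conj_def by (rule SUP_upper) simp
  then show ?thesis using weight_vanish[of 1] by (simp add: zero_ereal_def)
qed

text \<open>The factor of \<open>r\<^sub>m\<^sub>,\<^sub>n\<close> for \<open>u = n \<omega>(x)\<close> and \<open>k = |\<alpha>|\<close>, as a real number; it is 0 if the
  Young conjugate is infinite.\<close>

definition decay :: "nat \<Rightarrow> real \<Rightarrow> nat \<Rightarrow> real" where
  "decay m u k = real_of_ereal
     (ereal_exp (- ereal u - ereal (real m) * young_conj \<omega> (real k / real m)))"

text \<open>Since \<open>m \<ge> 1\<close>, an infinite conjugate stays infinite after
  multiplication by \<open>m\<close>, and its exponential is 0. The split moves later estimates from
  \<open>ereal\<close> to \<open>real\<close>.\<close>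

lemma decay_cases:
  assumes "m \<ge> 1"
  obtains (infinite) "young_conj \<omega> (real k / real m) = \<infinity>" "\<And>u. decay m u k = 0"
    "\<And>u. ereal_exp (- ereal u - ereal (real m) * young_conj \<omega> (real k / real m)) = 0"
  | (finite) r where "young_conj \<omega> (real k / real m) = ereal r"
    "\<And>u. decay m u k = exp (- u - real m * r)"
    "\<And>u. ereal_exp (- ereal u - ereal (real m) * young_conj \<omega> (real k / real m))
      = ereal (exp (- u - real m * r))"
proof (cases "young_conj \<omega> (real k / real m)")
  case PInf
  with assms show ?thesis
    by (intro infinite) (auto simp: decay_def simp flip: MInfty_eq_minfinity)
next
  case MInf
  then show ?thesis using young_conj_nonneg[of "real k / real m"] by simp
next
  case (real r)
  then show ?thesis by (intro finite) (auto simp: decay_def)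
qed

lemma decay_nonneg: "m \<ge> 1 \<Longrightarrow> 0 \<le> decay m u k"
  by (cases rule: decay_cases[of m k]) auto

lemma ereal_decay:
  "m \<ge> 1 \<Longrightarrow> ereal_exp (- ereal u - ereal (real m) * young_conj \<omega> (real k / real m))
    = ereal (decay m u k)"
  by (cases rule: decay_cases[of m k]) auto

lemma decay_antimono: "m \<ge> 1 \<Longrightarrow> u \<le> v \<Longrightarrow> decay m v k \<le> decay m u k"
  by (cases rule: decay_cases[of m k]) auto

text \<open>Every \<open>t \<ge> 0\<close> competes in the supremum, hence
  \<open>k t - m \<omega>(e^t)\<close> is at most \<open>m\<close> times the conjugate at
  \<open>k / m\<close>. An infinite conjugate makes the left side 0.\<close>

lemma decay_le:
  assumes "m \<ge> 1" "t \<ge> 0" "u \<ge> 0"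
  shows "decay m u k \<le> exp (real m * \<omega> (exp t) - real k * t)"
proof (cases rule: decay_cases[OF assms(1), of k])
  case (2 r)
  have "ereal (real k / real m * t - \<omega> (exp t)) \<le> young_conj \<omega> (real k / real m)"
    unfolding young_conj_def by (rule SUP_upper) (use assms in auto)
  then have "real k / real m * t - \<omega> (exp t) \<le> r" using 2 by simp
  then have "real m * (real k / real m * t - \<omega> (exp t)) \<le> real m * r"
    by (rule mult_left_mono) simp
  then have "real k * t - real m * \<omega> (exp t) \<le> real m * r"
    using assms by (simp add: algebra_simps)
  then show ?thesis using assms 2 by simp
qed simp

text \<open>Conversely, a common upper bound of these terms bounds \<open>m\<close> times the
  conjugate and forces it to be finite. Together with \<open>decay_le\<close> this gives control of
  \<open>decay\<close> by real inequalities in both directions.\<close>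

lemma decay_ge:
  assumes "m \<ge> 1" "\<And>t. t \<ge> 0 \<Longrightarrow> real k * t - real m * \<omega> (exp t) \<le> R"
  shows "exp (- R) \<le> decay m 0 k"
proof -
  have "ereal (real k / real m * t - \<omega> (exp t)) \<le> ereal (R / real m)" if "t \<ge> 0" for t
  proof -
    have "real k / real m * t - \<omega> (exp t) = (real k * t - real m * \<omega> (exp t)) / real m"
      using assms(1) by (simp add: field_simps)
    also have "\<dots> \<le> R / real m" using assms(2)[OF that] by (rule divide_right_mono) simp
    finally show ?thesis by simp
  qed
  then have *: "young_conj \<omega> (real k / real m) \<le> ereal (R / real m)"
    unfolding young_conj_def by (intro SUP_least) auto
  show ?thesis
  proof (cases rule: decay_cases[OF assms(1), of k])
    case (2 r)
    with * assms(1) show ?thesis by (simp add: field_simps)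
  qed (use * in simp)
qed

text \<open>By \<open>(\<gamma>)\<close>, \<open>\<omega>(e^t)\<close> is at least
  \<open>a + b t\<close>. Once \<open>m b \<ge> k\<close>, the linear terms compensate and
  \<open>- m a\<close> bounds the supremum. The conjugate may be infinite for small
  \<open>m\<close>, so \<open>m\<close> depends on \<open>k\<close>.\<close>

lemma decay_pos: "\<exists>m\<ge>1. 0 < decay m 0 k"
proof -
  obtain a b where ab: "b > 0" "\<And>t. t \<ge> 0 \<Longrightarrow> a + b * ln (1 + t) \<le> \<omega> t"
    using weight_log by blast
  define m where "m = nat \<lceil>real k / b\<rceil> + 1"
  have m: "real k \<le> real m * b"
  proof -
    have "real k / b \<le> real m" unfolding m_def by linarith
    then show ?thesis using ab by (simp add: field_simps)
  qed
  have "real k * t - real m * \<omega> (exp t) \<le> - (real m * a)" if t: "t \<ge> 0" for t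
  proof -
    have "t = ln (exp t)" by simp
    also have "\<dots> \<le> ln (1 + exp t)" by (subst ln_le_cancel_iff) (auto simp: add_pos_pos)
    finally have "a + b * t \<le> \<omega> (exp t)" using ab(1) ab(2)[of "exp t"]
      by (smt (verit) exp_ge_zero mult_left_mono)
    then have "real m * (a + b * t) \<le> real m * \<omega> (exp t)" by (rule mult_left_mono) simp
    moreover have "real k * t \<le> real m * b * t" using m t by (rule mult_right_mono)
    ultimately show ?thesis by (simp add: algebra_simps)
  qed
  from decay_ge[OF _ this] have "exp (- (- (real m * a))) \<le> decay m 0 k" by (simp add: m_def)
  then have "0 < decay m 0 k" by (rule less_le_trans[OF exp_gt_zero])
  then show ?thesis by (intro exI[of _ m]) (auto simp: m_def)
qed

section \<open>Weighted derivatives and the spaces they define\<close>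

definition weighted_deriv ::
    "nat \<Rightarrow> nat \<Rightarrow> ('n::finite \<Rightarrow> nat) \<Rightarrow> real^'n \<Rightarrow> (real^'n \<Rightarrow> complex) \<Rightarrow> complex" where
  "weighted_deriv m n \<alpha> x f =
     multi_deriv \<alpha> f x * of_real (decay m (real n * \<omega> (norm x)) (sum \<alpha> UNIV))"

lemma cmod_weighted_deriv:
  "m \<ge> 1 \<Longrightarrow> cmod (weighted_deriv m n \<alpha> x f)
    = cmod (multi_deriv \<alpha> f x) * decay m (real n * \<omega> (norm x)) (sum \<alpha> UNIV)"
  by (simp add: weighted_deriv_def norm_mult decay_nonneg)

lemma r_norm_eq: "m \<ge> 1 \<Longrightarrow> r_norm \<omega> m n f = (SUP \<alpha>. SUP x. ereal (cmod (weighted_deriv m n \<alpha> x f)))"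
  by (simp only: r_norm_def ereal_decay cmod_weighted_deriv times_ereal.simps)

lemma r_norm_le_iff:
  "m \<ge> 1 \<Longrightarrow> r_norm \<omega> m n f \<le> ereal C \<longleftrightarrow> (\<forall>\<alpha> x. cmod (weighted_deriv m n \<alpha> x f) \<le> C)"
  by (simp add: r_norm_eq SUP_le_iff)

lemma r_norm_nonneg:
  assumes "m \<ge> 1"
  shows "0 \<le> r_norm \<omega> m n f"
proof -
  have "ereal 0 \<le> ereal (cmod (weighted_deriv m n (\<lambda>_. 0) 0 f))" by simp
  also have "\<dots> \<le> r_norm \<omega> m n f"
    unfolding r_norm_eq[OF assms] by (intro SUP_upper2[of "\<lambda>_. 0"] SUP_upper2[of 0]) auto
  finally show ?thesis by (simp add: zero_ereal_def)
qed

lemma O_space_iff: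
  assumes "m \<ge> 1"
  shows "f \<in> O_space \<omega> m n \<longleftrightarrow> smooth f \<and> (\<exists>C. \<forall>\<alpha> x. cmod (weighted_deriv m n \<alpha> x f) \<le> C)"
proof -
  have "r_norm \<omega> m n f < \<infinity> \<longleftrightarrow> (\<exists>C. r_norm \<omega> m n f \<le> ereal C)"
    using r_norm_nonneg[OF assms, of n f] by (cases "r_norm \<omega> m n f") auto
  then show ?thesis by (simp add: O_space_def r_norm_le_iff[OF assms])
qed

lemma O_space_smooth: "f \<in> O_space \<omega> m n \<Longrightarrow> smooth f"
  by (simp add: O_space_def)

lemma weighted_deriv_add:
  fixes f g :: "real^'n::finite \<Rightarrow> complex"
  shows "smooth f \<Longrightarrow> smooth g \<Longrightarrow>
    weighted_deriv m n \<alpha> x (f + g) = weighted_deriv m n \<alpha> x f + weighted_deriv m n \<alpha> x g"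
  unfolding weighted_deriv_def by (subst multi_deriv_add) (auto simp: algebra_simps)

lemma weighted_deriv_cscale:
  "smooth f \<Longrightarrow> weighted_deriv m n \<alpha> x (cscale c f) = c * weighted_deriv m n \<alpha> x f"
  unfolding weighted_deriv_def by (subst multi_deriv_cscale) auto

text \<open>The factor \<open>exp (k t)\<close> of the derivatives of order \<open>k\<close> cancels
  against \<open>decay_le\<close> at the same \<open>t\<close>. What remains is independent of
  \<open>\<alpha>\<close>, \<open>x\<close> and \<open>n\<close>.\<close>

lemma cmod_weighted_deriv_wave_le:
  assumes "m \<ge> 1" "t \<ge> 0" "\<bar>s\<bar> \<le> exp t"
  shows "cmod (weighted_deriv m n \<alpha> x (wave i c s)) \<le> cmod c * exp (real m * \<omega> (exp t))"
proof -
  have "cmod (weighted_deriv m n \<alpha> x (wave i c s))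
      \<le> (cmod c * exp (real (sum \<alpha> UNIV) * t)) * exp (real m * \<omega> (exp t) - real (sum \<alpha> UNIV) * t)"
    unfolding cmod_weighted_deriv[OF assms(1)]
    by (intro mult_mono cmod_multi_deriv_wave_le decay_le decay_nonneg)
      (use assms weight_nonneg in auto)
  then show ?thesis by (simp add: exp_diff)
qed

lemma wave_in_O_space:
  assumes "m \<ge> 1"
  shows "wave i c s \<in> O_space \<omega> m n"
proof -
  have "\<bar>s\<bar> \<le> exp \<bar>s\<bar>" using exp_ge_add_one_self[of "\<bar>s\<bar>"] by linarith
  from cmod_weighted_deriv_wave_le[OF assms _ this] show ?thesis
    unfolding O_space_iff[OF assms] using smooth_wave by (metis abs_ge_zero)
qed

lemma O_space_subspace:
  assumes m: "m \<ge> 1"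
  shows "cfun_subspace (O_space \<omega> m n :: (real^'n::finite \<Rightarrow> complex) set)"
proof (rule cfun.subspaceI)
  \<comment> \<open>The zero function is the wave of amplitude 0 along any axis.\<close>
  have "wave undefined 0 0 \<in> (O_space \<omega> m n :: (real^'n \<Rightarrow> complex) set)"
    using wave_in_O_space[OF m] .
  then show "0 \<in> (O_space \<omega> m n :: (real^'n \<Rightarrow> complex) set)" by (simp add: wave_def[abs_def] zero_fun_def)
next
  fix f g :: "real^'n \<Rightarrow> complex"
  assume fg: "f \<in> O_space \<omega> m n" "g \<in> O_space \<omega> m n"
  then obtain C D where "\<forall>\<alpha> x. cmod (weighted_deriv m n \<alpha> x f) \<le> C"
      "\<forall>\<alpha> x. cmod (weighted_deriv m n \<alpha> x g) \<le> D"
    unfolding O_space_iff[OF m] by blast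
  then have "\<forall>\<alpha> x. cmod (weighted_deriv m n \<alpha> x (f + g)) \<le> C + D"
    unfolding weighted_deriv_add[OF O_space_smooth[OF fg(1)] O_space_smooth[OF fg(2)]]
    by (meson add_mono norm_triangle_le)
  then show "f + g \<in> O_space \<omega> m n"
    using smooth_add[OF O_space_smooth[OF fg(1)] O_space_smooth[OF fg(2)]]
    unfolding O_space_iff[OF m] by blast
next
  fix f :: "real^'n \<Rightarrow> complex" and c
  assume f: "f \<in> O_space \<omega> m n"
  then obtain C where "\<forall>\<alpha> x. cmod (weighted_deriv m n \<alpha> x f) \<le> C"
    unfolding O_space_iff[OF m] by blast
  then have "\<forall>\<alpha> x. cmod (weighted_deriv m n \<alpha> x (cscale c f)) \<le> cmod c * C"
    unfolding weighted_deriv_cscale[OF O_space_smooth[OF f]] norm_mult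
    by (simp add: mult_left_mono)
  then show "cscale c f \<in> O_space \<omega> m n"
    using smooth_cscale[OF O_space_smooth[OF f]] unfolding O_space_iff[OF m] by blast
qed

lemma O_space_mono:
  assumes m: "m \<ge> 1" and n: "n \<le> n'"
  shows "O_space \<omega> m n \<subseteq> O_space \<omega> m n'"
proof
  fix f assume f: "f \<in> O_space \<omega> m n"
  then obtain C where C: "\<And>\<alpha> x. cmod (weighted_deriv m n \<alpha> x f) \<le> C"
    unfolding O_space_iff[OF m] by blast
  have "cmod (weighted_deriv m n' \<alpha> x f) \<le> cmod (weighted_deriv m n \<alpha> x f)" for \<alpha> x
    unfolding cmod_weighted_deriv[OF m]
    using n weight_nonneg by (intro mult_left_mono decay_antimono m mult_right_mono) auto
  with C have "cmod (weighted_deriv m n' \<alpha> x f) \<le> C" for \<alpha> x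
    using order_trans by blast
  then show "f \<in> O_space \<omega> m n'"
    using O_space_smooth[OF f] unfolding O_space_iff[OF m] by blast
qed

lemma subspace_UN_mono:
  fixes E :: "nat \<Rightarrow> ('a \<Rightarrow> complex) set"
  assumes "\<And>n. n \<ge> 1 \<Longrightarrow> cfun_subspace (E n)" "\<And>n n'. n \<le> n' \<Longrightarrow> E n \<subseteq> E n'"
  shows "cfun_subspace (\<Union>n\<in>{1::nat..}. E n)"
proof (rule cfun.subspaceI)
  show "0 \<in> (\<Union>n\<in>{1..}. E n)" using cfun.subspace_0[OF assms(1)[of 1]] by auto
next
  fix f g assume "f \<in> (\<Union>n\<in>{1..}. E n)" "g \<in> (\<Union>n\<in>{1..}. E n)"
  then obtain n n' where n: "n \<ge> 1" "f \<in> E n" "g \<in> E n'" by auto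
  then have "f \<in> E (max n n')" "g \<in> E (max n n')"
    using assms(2)[of n "max n n'"] assms(2)[of n' "max n n'"] by auto
  then have "f + g \<in> E (max n n')" using cfun.subspace_add[OF assms(1)[of "max n n'"]] n by auto
  then show "f + g \<in> (\<Union>n\<in>{1..}. E n)" using n by (intro UN_I[of "max n n'"]) auto
next
  fix f c assume "f \<in> (\<Union>n\<in>{1..}. E n)"
  then show "cscale c f \<in> (\<Union>n\<in>{1..}. E n)" using cfun.subspace_scale assms(1) by fastforce
qed

lemma seminorm_on_r_norm:
  assumes m: "m \<ge> 1"
  shows "seminorm_on (O_space \<omega> m n) (\<lambda>f. real_of_ereal (r_norm \<omega> m n f))"
proof (rule seminorm_on_sup[where L = "\<lambda>(\<alpha>, x). weighted_deriv m n \<alpha> x", OF O_space_subspace[OF m]])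
  fix f C assume f: "f \<in> O_space \<omega> m n"
  then have "r_norm \<omega> m n f < \<infinity>" by (simp add: O_space_def)
  \<comment> \<open>The value is finite and nonnegative here, so \<open>real_of_ereal\<close> loses
    nothing.\<close>
  then have "real_of_ereal (r_norm \<omega> m n f) \<le> C \<longleftrightarrow> r_norm \<omega> m n f \<le> ereal C"
    using r_norm_nonneg[OF m, of n f] by (cases "r_norm \<omega> m n f") auto
  then show "real_of_ereal (r_norm \<omega> m n f) \<le> C
      \<longleftrightarrow> (\<forall>z. cmod ((case z of (\<alpha>, x) \<Rightarrow> weighted_deriv m n \<alpha> x) f) \<le> C)"
    by (simp add: r_norm_le_iff[OF m])
qed (auto simp: weighted_deriv_add weighted_deriv_cscale O_space_smooth split: prod.splits)

lemma r_norm_wave_le: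
  assumes "m \<ge> 1" "t \<ge> 0" "\<bar>s\<bar> \<le> exp t"
  shows "real_of_ereal (r_norm \<omega> m n (wave i c s)) \<le> cmod c * exp (real m * \<omega> (exp t))"
proof -
  have "r_norm \<omega> m n (wave i c s) \<le> ereal (cmod c * exp (real m * \<omega> (exp t)))"
    unfolding r_norm_le_iff[OF assms(1)] using cmod_weighted_deriv_wave_le[OF assms] by blast
  then show ?thesis
    using r_norm_nonneg[OF assms(1), of n "wave i c s"]
    by (cases "r_norm \<omega> m n (wave i c s)") auto
qed

text \<open>The restriction of \<open>r\<^sub>m\<^sub>,\<^sub>n\<close> to \<open>x = 0\<close>, which does not depend on \<open>n\<close> as \<open>\<omega>(0) = 0\<close>.\<close>

definition origin_norm :: "nat \<Rightarrow> (real^'n::finite \<Rightarrow> complex) \<Rightarrow> real" where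
  "origin_norm m f = (SUP \<alpha>. cmod (weighted_deriv m 0 \<alpha> 0 f))"

lemma weighted_deriv_origin: "weighted_deriv m n \<alpha> 0 f = weighted_deriv m 0 \<alpha> 0 f"
  using weight_vanish[of 0] by (simp add: weighted_deriv_def)

text \<open>The real supremum needs a bounded family; the bound for any one \<open>n\<close>
  supplies it, as the weight at the origin is the same for all \<open>n\<close>.\<close>

lemma origin_norm_le_iff:
  assumes m: "m \<ge> 1" and f: "f \<in> O_space \<omega> m n"
  shows "origin_norm m f \<le> C \<longleftrightarrow> (\<forall>\<alpha>. cmod (weighted_deriv m 0 \<alpha> 0 f) \<le> C)"
proof -
  obtain D where "\<And>\<alpha> x. cmod (weighted_deriv m n \<alpha> x f) \<le> D"
    using f unfolding O_space_iff[OF m] by blast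
  from this[of _ 0] have "bdd_above (range (\<lambda>\<alpha>. cmod (weighted_deriv m 0 \<alpha> 0 f)))"
    unfolding weighted_deriv_origin[of m n] by (rule bdd_aboveI2)
  then show ?thesis unfolding origin_norm_def by (subst cSUP_le_iff) auto
qed

lemma origin_norm_ge:
  assumes "m \<ge> 1" "f \<in> O_space \<omega> m n"
  shows "cmod (weighted_deriv m 0 \<alpha> 0 f) \<le> origin_norm m f"
  using origin_norm_le_iff[OF assms, of "origin_norm m f"] by blast

lemma seminorm_on_origin_norm:
  assumes m: "m \<ge> 1" and E: "cfun_subspace E" "E \<subseteq> (\<Union>n\<in>{1..}. O_space \<omega> m n)"
  shows "seminorm_on E (origin_norm m)"
proof -
  have "\<exists>n. f \<in> O_space \<omega> m n" if "f \<in> E" for f using E(2) that by blast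
  then show ?thesis
    using E(1) origin_norm_le_iff[OF m] O_space_smooth
    by (intro seminorm_on_sup[where L = "\<lambda>\<alpha>. weighted_deriv m 0 \<alpha> 0"] weighted_deriv_add
        weighted_deriv_cscale) blast+
qed

lemma origin_norm_le_r_norm:
  assumes m: "m \<ge> 1" and f: "f \<in> O_space \<omega> m n"
  shows "origin_norm m f \<le> real_of_ereal (r_norm \<omega> m n f)"
proof -
  have "\<bar>r_norm \<omega> m n f\<bar> \<noteq> \<infinity>"
    using f r_norm_nonneg[OF m, of n f] by (auto simp: O_space_def)
  then have "r_norm \<omega> m n f \<le> ereal (real_of_ereal (r_norm \<omega> m n f))"
    by (simp add: ereal_real)
  then show ?thesis
    unfolding r_norm_le_iff[OF m] origin_norm_le_iff[OF m f]
    using weighted_deriv_origin by metis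
qed

lemma topspace_O_top: "topspace (O_top \<omega> m n) = O_space \<omega> m n"
  by (simp add: O_top_def)

lemma seminorm_continuous_O_top:
  assumes m: "m \<ge> 1"
  shows "seminorm_continuous (O_top \<omega> m n) (origin_norm m)"
  unfolding seminorm_continuous_def
proof (intro ballI allI impI)
  let ?E = "O_space \<omega> m n" and ?q = "origin_norm m" and ?p = "\<lambda>f. real_of_ereal (r_norm \<omega> m n f)"
  fix f and \<epsilon> :: real assume f: "f \<in> topspace (O_top \<omega> m n)" and "\<epsilon> > 0"
  note E = O_space_subspace[OF m, of n] and iff = openin_seminorm_topology_iff[OF seminorm_on_r_norm[OF m]]
  have f: "f \<in> ?E" using f by (simp add: O_top_def)
  have "seminorm_on ?E ?q"
    using seminorm_on_r_norm[OF m, of n] E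
    by (intro seminorm_on_sup[where L = "\<lambda>\<alpha>. weighted_deriv m 0 \<alpha> 0"] origin_norm_le_iff[OF m]
        weighted_deriv_add weighted_deriv_cscale) (auto intro: O_space_smooth)
  note tri = seminorm_on_triangle[OF this f]
  have "openin (seminorm_topology ?E {?p}) {g \<in> ?E. ?q (g - f) < \<epsilon>}"
    unfolding iff
  proof (intro conjI ballI)
    fix g assume g: "g \<in> {g \<in> ?E. ?q (g - f) < \<epsilon>}"
    show "\<exists>\<delta>>0. \<forall>h\<in>?E. ?p (h - g) < \<delta> \<longrightarrow> h \<in> {g \<in> ?E. ?q (g - f) < \<epsilon>}"
    proof (intro exI[of _ "\<epsilon> - ?q (g - f)"] conjI ballI impI)
      fix h assume h: "h \<in> ?E" "?p (h - g) < \<epsilon> - ?q (g - f)"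
      moreover have "?q (h - g) \<le> ?p (h - g)"
        using cfun.subspace_diff[OF E] g h by (intro origin_norm_le_r_norm[OF m]) auto
      ultimately show "h \<in> {g \<in> ?E. ?q (g - f) < \<epsilon>}" using tri[of g h] g by auto
    qed (use g in auto)
  qed auto
  then show "openin (O_top \<omega> m n) {g \<in> topspace (O_top \<omega> m n). ?q (g - f) < \<epsilon>}"
    by (simp add: O_top_def)
qed

section \<open>Waves in neighbourhoods of zero\<close>

text \<open>Open sets of iterated limits are hard to describe, so only their trace on waves is
  recorded. The quantity kept below \<open>\<delta>\<close> is the bound from
  \<open>r_norm_wave_le\<close>, which is free of \<open>n\<close>; thus one notion serves all steps
  of the inductive limits.\<close>

definition contains_small_waves :: "'n::finite \<Rightarrow> nat \<Rightarrow> (real^'n \<Rightarrow> complex) set \<Rightarrow> bool" where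
  "contains_small_waves i m V \<longleftrightarrow> (\<exists>\<delta>>0. \<forall>c s t. t \<ge> 0 \<longrightarrow> \<bar>s\<bar> \<le> exp t \<longrightarrow>
     cmod c * exp (real m * \<omega> (exp t)) < \<delta> \<longrightarrow> wave i c s \<in> V)"

definition small_waves :: "'n::finite \<Rightarrow> (real^'n \<Rightarrow> complex) topology \<Rightarrow> bool" where
  "small_waves i \<tau> \<longleftrightarrow> (\<forall>c s. wave i c s \<in> topspace \<tau>) \<and>
     (\<forall>V. openin \<tau> V \<longrightarrow> 0 \<in> V \<longrightarrow> (\<exists>m\<ge>1. contains_small_waves i m V))"

lemma contains_small_waves_mono:
  fixes V V' :: "(real^'n::finite \<Rightarrow> complex) set"
  assumes "contains_small_waves i m V" "m \<le> m'" "V \<subseteq> V'"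
  shows "contains_small_waves i m' V'"
proof -
  obtain \<delta> where \<delta>: "\<delta> > 0" "\<And>c s t. t \<ge> 0 \<Longrightarrow> \<bar>s\<bar> \<le> exp t \<Longrightarrow>
     cmod c * exp (real m * \<omega> (exp t)) < \<delta> \<Longrightarrow> wave i c s \<in> V"
    using assms(1) unfolding contains_small_waves_def by blast
  have "cmod c * exp (real m * \<omega> (exp t)) \<le> cmod c * exp (real m' * \<omega> (exp t))" for c t
    using assms(2) weight_nonneg[of "exp t"] by (intro mult_left_mono) (auto intro: mult_right_mono)
  with \<delta> assms(3) show ?thesis
    unfolding contains_small_waves_def by (meson le_less_trans subsetD)
qed

lemma contains_small_waves_Int:
  fixes V V' :: "(real^'n::finite \<Rightarrow> complex) set"
  assumes "contains_small_waves i m V" "contains_small_waves i m V'"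
  shows "contains_small_waves i m (V \<inter> V')"
proof -
  obtain \<delta> \<delta>' where "\<delta> > 0" "\<And>c s t. t \<ge> 0 \<Longrightarrow> \<bar>s\<bar> \<le> exp t \<Longrightarrow>
     cmod c * exp (real m * \<omega> (exp t)) < \<delta> \<Longrightarrow> wave i c s \<in> V"
   "\<delta>' > 0" "\<And>c s t. t \<ge> 0 \<Longrightarrow> \<bar>s\<bar> \<le> exp t \<Longrightarrow>
     cmod c * exp (real m * \<omega> (exp t)) < \<delta>' \<Longrightarrow> wave i c s \<in> V'"
    using assms unfolding contains_small_waves_def by metis
  then show ?thesis
    unfolding contains_small_waves_def by (intro exI[of _ "min \<delta> \<delta>'"]) auto
qed

lemma small_waves_O_top:
  fixes i :: "'n::finite"
  assumes m: "m \<ge> 1"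
  shows "small_waves i (O_top \<omega> m n)"
  unfolding small_waves_def
proof (intro conjI allI impI)
  show "wave i c s \<in> topspace (O_top \<omega> m n)" for c s
    by (simp add: topspace_O_top wave_in_O_space[OF m])
  fix V :: "(real^'n \<Rightarrow> complex) set"
  assume V: "openin (O_top \<omega> m n) V" "0 \<in> V"
  then obtain \<delta> where \<delta>: "\<delta> > 0"
    "\<And>g. g \<in> O_space \<omega> m n \<Longrightarrow> real_of_ereal (r_norm \<omega> m n (g - 0)) < \<delta> \<Longrightarrow> g \<in> V"
    unfolding O_top_def openin_seminorm_topology_iff[OF seminorm_on_r_norm[OF m]] by blast
  have "contains_small_waves i m V"
    unfolding contains_small_waves_def
  proof (intro exI[of _ \<delta>] conjI allI impI)
    fix c s t
    assume "0 \<le> t" "\<bar>s\<bar> \<le> exp t" "cmod c * exp (real m * \<omega> (exp t)) < \<delta>"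
    with r_norm_wave_le[OF m this(1,2), of n i c] show "wave i c s \<in> V"
      by (intro \<delta>(2) wave_in_O_space[OF m]) (simp add: diff_zero del: fun_diff_def)
  qed (fact \<delta>)
  then show "\<exists>m\<ge>1. contains_small_waves i m V" using m by blast
qed

text \<open>A single step suffices: an open set of the limit meets it in an open set of the step,
  which already contains the small waves.\<close>

lemma small_waves_ind_limit:
  assumes "j \<in> I" "small_waves i (\<tau> j)"
  shows "small_waves i (ind_limit I \<tau>)"
  unfolding small_waves_def
proof (intro conjI allI impI)
  show "wave i c s \<in> topspace (ind_limit I \<tau>)" for c s
    using assms by (auto simp: small_waves_def topspace_ind_limit)
  fix V assume V: "openin (ind_limit I \<tau>) V" "0 \<in> V"
  have "wave i 0 0 \<in> topspace (\<tau> j)" using assms by (simp add: small_waves_def)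
  then have "0 \<in> topspace (\<tau> j)" by (simp add: wave_def[abs_def] zero_fun_def)
  moreover have "openin (\<tau> j) {f \<in> topspace (\<tau> j). f \<in> V}"
    using continuous_map_into_ind_limit[OF assms(1), of \<tau>] V by (auto simp: continuous_map_def)
  ultimately obtain m where "m \<ge> 1" "contains_small_waves i m {f \<in> topspace (\<tau> j). f \<in> V}"
    using assms(2) V unfolding small_waves_def by blast
  then show "\<exists>m\<ge>1. contains_small_waves i m V"
    using contains_small_waves_mono[OF _ order_refl] by blast
qed

text \<open>A basic open set involves finitely many steps, each with its own index, and the maximum
  of the indices serves for the intersection. This is why \<open>m\<close> in
  \<open>small_waves\<close> may depend on \<open>V\<close>.\<close>

lemma small_waves_proj_limit:
  assumes I: "I \<noteq> {}" and "\<And>j. j \<in> I \<Longrightarrow> small_waves i (\<tau> j)"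
  shows "small_waves i (proj_limit I \<tau>)"
proof -
  have w: "wave i c s \<in> (\<Inter>j\<in>I. topspace (\<tau> j))" for c s
    using assms by (auto simp: small_waves_def)
  have "\<exists>m\<ge>1. contains_small_waves i m V" if V: "openin (proj_limit I \<tau>) V" "0 \<in> V" for V
  proof -
    have "generate_topology_on {(\<Inter>j\<in>I. topspace (\<tau> j)) \<inter> U | j U. j \<in> I \<and> openin (\<tau> j) U} V"
      using V(1) unfolding proj_limit_def openin_topology_generated_by_iff .
    then show ?thesis using V(2)
    proof induction
      case (Int a b)
      then obtain m m' where "m \<ge> 1" "contains_small_waves i m a" "contains_small_waves i m' b"
        by blast
      then have "contains_small_waves i (max m m') a" "contains_small_waves i (max m m') b"
        by (auto intro: contains_small_waves_mono)
      with \<open>m \<ge> 1\<close> show ?case by (intro exI[of _ "max m m'"]) (auto intro: contains_small_waves_Int)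
    next
      case (UN K)
      then obtain U m where "U \<in> K" "m \<ge> 1" "contains_small_waves i m U" by blast
      then show ?case by (meson Union_upper contains_small_waves_mono order_refl)
    next
      case (Basis U)
      then obtain j W where j: "U = (\<Inter>j\<in>I. topspace (\<tau> j)) \<inter> W" "j \<in> I" "openin (\<tau> j) W" by blast
      have "0 \<in> W" using Basis j by blast
      then obtain m where m: "m \<ge> 1" "contains_small_waves i m W"
        using assms(2)[OF j(2)] j(3) unfolding small_waves_def by blast
      then have "contains_small_waves i m U"
        using w unfolding contains_small_waves_def j(1) by blast
      with m show ?case by blast
    qed auto
  qed
  then show ?thesis
    using w unfolding small_waves_def topspace_proj_limit[OF I] by blast
qed

section \<open>Discontinuity of the multiplication\<close>

text \<open>The constant 1 is \<open>r\<close> times the wave of amplitude \<open>1 / r\<close> and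
  frequency 0, which is small for large \<open>r\<close>. Boundedness of \<open>{1}\<close> makes
  \<open>cmod (T 1)\<close> a seminorm of the strong dual.\<close>

lemma tvs_bounded_one:
  fixes \<tau> :: "(real^'n::finite \<Rightarrow> complex) topology"
  assumes "small_waves i \<tau>"
  shows "tvs_bounded \<tau> {1}"
proof -
  have one: "cscale (of_real r) (wave i (of_real (1 / r)) 0) = 1" if "r > 0" for r :: real
    using that by (auto simp: cscale_def wave_def fun_eq_iff)
  from assms have "wave i 1 0 \<in> topspace \<tau>" by (simp add: small_waves_def)
  moreover have "wave i 1 0 = 1" using one[of 1] by simp
  moreover have "\<exists>s>0. \<forall>r>s. {1} \<subseteq> cscale (of_real r) ` U" if U: "openin \<tau> U \<and> 0 \<in> U" for U
  proof -
    obtain m where "contains_small_waves i m U"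
      using assms U unfolding small_waves_def by blast
    then obtain \<delta> where \<delta>: "\<delta> > 0" "\<And>c s t. t \<ge> 0 \<Longrightarrow> \<bar>s\<bar> \<le> exp t \<Longrightarrow>
        cmod c * exp (real m * \<omega> (exp t)) < \<delta> \<Longrightarrow> wave i c s \<in> U"
      unfolding contains_small_waves_def by blast
    have "{1} \<subseteq> cscale (of_real r) ` U" if r: "r > 1 / \<delta>" for r
    proof -
      have r0: "r > 0" using r \<delta>(1) by (meson divide_pos_pos less_trans zero_less_one)
      have "wave i (of_real (1 / r)) 0 \<in> U"
      proof (rule \<delta>(2)[of 0])
        \<comment> \<open>Frequency 0 allows \<open>t = 0\<close>, where
          \<open>\<omega> (exp 0) = 0\<close> makes the exponential factor 1.\<close>
        have "cmod (of_real (1 / r)) * exp (real m * \<omega> (exp 0)) = 1 / r"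
          using r0 weight_vanish[of 1] by (simp add: norm_divide)
        also have "\<dots> < \<delta>" using r r0 \<delta>(1) by (simp add: field_simps)
        finally show "cmod (of_real (1 / r)) * exp (real m * \<omega> (exp 0)) < \<delta>" .
      qed auto
      then have "cscale (of_real r) (wave i (of_real (1 / r)) 0) \<in> cscale (of_real r) ` U"
        by (rule imageI)
      then show ?thesis unfolding one[OF r0] by simp
    qed
    then show ?thesis using \<delta>(1) by (intro exI[of _ "1 / \<delta>"]) auto
  qed
  ultimately show ?thesis by (auto simp: tvs_bounded_def)
qed

text \<open>With \<open>m\<close> from \<open>decay_pos\<close>, the weight \<open>w\<close> of this
  order at the origin is positive, so \<open>origin_norm m\<close> dominates the derivative at 0 up
  to the factor \<open>1 / w\<close>. Its continuity gives that of the functional.\<close>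

lemma derivative_in_dual:
  fixes \<tau> :: "(real^'n::finite \<Rightarrow> complex) topology"
  assumes E: "cfun_subspace (topspace \<tau>)"
    and sub: "\<And>m. m \<ge> 1 \<Longrightarrow> topspace \<tau> \<subseteq> (\<Union>n\<in>{1..}. O_space \<omega> m n)"
    and cont: "\<And>m. m \<ge> 1 \<Longrightarrow> seminorm_continuous \<tau> (origin_norm m)"
  shows "(\<lambda>g\<in>topspace \<tau>. c * multi_deriv \<alpha> g 0) \<in> dual \<tau>"
proof -
  let ?E = "topspace \<tau>" and ?T = "\<lambda>g\<in>topspace \<tau>. c * multi_deriv \<alpha> g 0"
  have smooth: "smooth g" if "g \<in> ?E" for g
    using sub[of 1] that O_space_smooth by blast
  obtain m where m: "m \<ge> 1" and pos: "decay m 0 (sum \<alpha> UNIV) > 0" using decay_pos by blast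
  define w where "w = decay m 0 (sum \<alpha> UNIV)"
  note q = seminorm_on_origin_norm[OF m E sub[OF m]]
  have lip: "cmod (?T g - ?T f) * w \<le> cmod c * origin_norm m (g - f)" if fg: "f \<in> ?E" "g \<in> ?E" for f g
  proof -
    have d: "g - f \<in> ?E" using cfun.subspace_diff[OF E] fg by blast
    then obtain n where n: "g - f \<in> O_space \<omega> m n" using sub[OF m] by blast
    have "multi_deriv \<alpha> (g - f + f) 0 = multi_deriv \<alpha> (g - f) 0 + multi_deriv \<alpha> f 0"
      by (rule multi_deriv_add) (use smooth d fg in auto)
    then have "?T g - ?T f = c * multi_deriv \<alpha> (g - f) 0"
      using fg by (simp add: algebra_simps del: fun_diff_def)
    then have "cmod (?T g - ?T f) * w = cmod c * cmod (weighted_deriv m 0 \<alpha> 0 (g - f))"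
      by (simp add: cmod_weighted_deriv[OF m] norm_mult w_def del: fun_diff_def)
    also have "\<dots> \<le> cmod c * origin_norm m (g - f)"
      by (intro mult_left_mono origin_norm_ge[OF m n]) auto
    finally show ?thesis .
  qed
  have "continuous_map \<tau> euclidean ?T"
    unfolding continuous_map_def
  proof (intro conjI allI impI)
    fix U :: "complex set" assume "openin euclidean U"
    then have U: "open U" by simp
    show "openin \<tau> {f \<in> topspace \<tau>. ?T f \<in> U}"
    proof (subst openin_subopen, intro ballI)
      fix f assume f: "f \<in> {f \<in> topspace \<tau>. ?T f \<in> U}"
      then obtain e where e: "e > 0" "ball (?T f) e \<subseteq> U"
        using U openE by blast
      \<comment> \<open>The summand 1 in the denominator covers \<open>c = 0\<close>.\<close>
      define \<epsilon> where "\<epsilon> = e * w / (cmod c + 1)"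
      have c: "cmod c + 1 > 0" by (simp add: add_nonneg_pos)
      have \<epsilon>: "\<epsilon> > 0" using e pos c by (simp add: \<epsilon>_def w_def)
      let ?V = "{g \<in> ?E. origin_norm m (g - f) < \<epsilon>}"
      have "?T g \<in> U" if g: "g \<in> ?V" for g
      proof -
        have "g - f \<in> ?E" using cfun.subspace_diff[OF E] f g by blast
        then have q0: "0 \<le> origin_norm m (g - f)" using seminorm_on_nonneg[OF q] by blast
        have "cmod (?T g - ?T f) * w \<le> cmod c * origin_norm m (g - f)"
          using lip f g by blast
        also have "\<dots> \<le> (cmod c + 1) * origin_norm m (g - f)"
          using q0 by (intro mult_right_mono) auto
        also have "\<dots> < (cmod c + 1) * \<epsilon>" using g c by (intro mult_strict_left_mono) auto
        also have "\<dots> = e * w" using c by (simp add: \<epsilon>_def)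
        finally have "cmod (?T g - ?T f) < e" using pos by (simp only: w_def mult_less_cancel_right_pos)
        then show ?thesis using e(2) by (auto simp: dist_norm norm_minus_commute subset_iff)
      qed
      moreover have "openin \<tau> ?V"
        using cont[OF m] f \<epsilon> unfolding seminorm_continuous_def by blast
      moreover have "f \<in> ?V" using f \<epsilon> seminorm_on_zero[OF q] by simp
      ultimately show "\<exists>V. openin \<tau> V \<and> f \<in> V \<and> V \<subseteq> {f \<in> topspace \<tau>. ?T f \<in> U}"
        by (intro exI[of _ ?V]) auto
    qed
  qed auto
  moreover have "?T (f + g) = ?T f + ?T g" if "f \<in> ?E" "g \<in> ?E" for f g
    using multi_deriv_add[OF smooth smooth, OF that, of \<alpha> 0] cfun.subspace_add[OF E that] that
    by (simp add: algebra_simps)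
  moreover have "?T (cscale a f) = a * ?T f" if "f \<in> ?E" for a f
    using multi_deriv_cscale[OF smooth[OF that]] cfun.subspace_scale[OF E that] that
    by simp
  ultimately show ?thesis by (simp add: dual_def)
qed

text \<open>By \<open>\<omega>(2t) \<le> K (1 + \<omega>(t))\<close>, shifting \<open>t\<close> by \<open>ln 2\<close> gains a factor \<open>2\<^sup>k\<close> at the expense of
  replacing \<open>m\<close> by \<open>K m\<close>. Hence \<open>m' \<phi>\<^sup>*(k / m') - m \<phi>\<^sup>*(k / m)\<close> is not bounded below in \<open>k\<close>; the
  case \<open>\<phi>\<^sup>*(k / m) = \<infinity>\<close> has to be treated apart.\<close>

lemma exp_not_dominated:
  assumes m: "m \<ge> 1" and C: "\<And>m'. m' \<ge> 1 \<Longrightarrow> C m' > 0"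
  shows "\<exists>k m' t. m' \<ge> 1 \<and> t \<ge> 0 \<and> decay m' 0 k > 0 \<and>
    C m' \<le> decay m' 0 k * exp (real k * t - real m * \<omega> (exp t))"
proof (rule ccontr)
  assume "\<not> ?thesis"
  then have *: "decay m' 0 k * exp (real k * t - real m * \<omega> (exp t)) < C m'"
    if "m' \<ge> 1" "t \<ge> 0" "decay m' 0 k > 0" for k m' t
    using that by (meson not_le)
  \<comment> \<open>Negated, the claim bounds \<open>k t - m \<omega>(e^t)\<close> over
    \<open>t\<close> for each \<open>k\<close>, through any \<open>m'\<close> with positive weight.
    The conjugate is thus finite at every \<open>k / m\<close>.\<close>
  have bound: "\<exists>R. \<forall>t\<ge>0. real k * t - real m * \<omega> (exp t) \<le> R" for k
  proof -
    obtain m' where m': "m' \<ge> 1" "decay m' 0 k > 0" using decay_pos by blast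
    have "real k * t - real m * \<omega> (exp t) \<le> ln (C m' / decay m' 0 k)" if "t \<ge> 0" for t
    proof -
      have "exp (real k * t - real m * \<omega> (exp t)) \<le> C m' / decay m' 0 k"
        using *[OF m'(1) that m'(2)] m'(2) by (simp add: field_simps)
      then show ?thesis using C[OF m'(1)] m'(2) by (subst ln_ge_iff) auto
    qed
    then show ?thesis by blast
  qed
  obtain K where K: "K \<ge> 1" "\<And>t. t \<ge> 0 \<Longrightarrow> \<omega> (2 * t) \<le> K * (1 + \<omega> t)"
    using weight_double by blast
  \<comment> \<open>With \<open>m' \<ge> m K\<close>, doubling the argument of
    \<open>\<omega>\<close> costs only the constant \<open>m K\<close> when \<open>m\<close> is
    traded for \<open>m'\<close>.\<close>
  define m' where "m' = m * nat \<lceil>K\<rceil>"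
  have "1 \<le> nat \<lceil>K\<rceil>" and K': "K \<le> real (nat \<lceil>K\<rceil>)" using K(1) by linarith+
  then have m': "m' \<ge> 1" "m' \<ge> m" using m by (auto simp: m'_def)
  have Km: "real m * K \<le> real m'"
    using K' by (simp add: m'_def mult_left_mono)
  \<comment> \<open>Finiteness passes from \<open>m\<close> to the larger \<open>m'\<close>, as
    \<open>\<omega>\<close> is nonnegative.\<close>
  have pos: "decay m' 0 k > 0" for k
  proof -
    obtain R where R: "\<And>t. t \<ge> 0 \<Longrightarrow> real k * t - real m * \<omega> (exp t) \<le> R" using bound by blast
    have "real k * t - real m' * \<omega> (exp t) \<le> R" if "t \<ge> 0" for t
    proof -
      have "real m * \<omega> (exp t) \<le> real m' * \<omega> (exp t)"
        using m' weight_nonneg by (intro mult_right_mono) auto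
      then show ?thesis using R[OF that] by simp
    qed
    from decay_ge[OF m'(1) this] show ?thesis by (meson exp_gt_zero less_le_trans)
  qed
  have "real k * ln 2 < ln (C m') + real m * K + 1" for k
  proof (rule ccontr)
    assume k: "\<not> ?thesis"
    \<comment> \<open>The negated claim is used at \<open>t + ln 2\<close>. The gain
      \<open>k ln 2\<close> exceeds the costs by at least 1, so the terms for \<open>m'\<close> stay
      1 below the value encoded in \<open>decay m' 0 k\<close>; \<open>decay_ge\<close> then makes
      this positive weight at least \<open>exp 1\<close> times itself.\<close>
    have "real k * t - real m' * \<omega> (exp t) \<le> - 1 - ln (decay m' 0 k)" if t: "t \<ge> 0" for t
    proof -
      have "decay m' 0 k * exp (real k * (t + ln 2) - real m * \<omega> (exp (t + ln 2))) < C m'"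
        using t by (intro * m' pos) auto
      then have "ln (decay m' 0 k * exp (real k * (t + ln 2) - real m * \<omega> (exp (t + ln 2)))) < ln (C m')"
        using pos[of k] C[OF m'(1)] by (subst ln_less_cancel_iff) auto
      then have "ln (decay m' 0 k) + (real k * (t + ln 2) - real m * \<omega> (exp (t + ln 2))) < ln (C m')"
        using pos[of k] by (simp add: ln_mult)
      moreover have "real m * \<omega> (exp (t + ln 2)) \<le> real m * (K * (1 + \<omega> (exp t)))"
        using K(2)[of "exp t"] by (intro mult_left_mono) (auto simp: exp_add mult.commute)
      moreover have "real m * K * \<omega> (exp t) \<le> real m' * \<omega> (exp t)"
        using Km weight_nonneg by (intro mult_right_mono) auto
      ultimately show ?thesis using k by (simp add: algebra_simps)
    qed
    from decay_ge[OF m'(1) this] have "exp 1 * decay m' 0 k \<le> decay m' 0 k"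
      using pos[of k] by (simp add: exp_add)
    moreover have "exp (1::real) > 1" by simp
    ultimately show False using pos[of k] by (simp add: mult_le_cancel_right2)
  qed
  moreover obtain k where "(ln (C m') + real m * K + 1) / ln 2 \<le> real k"
    using real_arch_simple by blast
  then have "ln (C m') + real m * K + 1 \<le> real k * ln 2" by (simp add: field_simps)
  ultimately show False by (meson not_le)
qed

text \<open>The hypotheses isolate what both spaces share: the first three give the functionals and
  the bounds on \<open>B\<close> for every \<open>m\<close>, the last one gives the functions that
  obstruct continuity.\<close>

lemma mult_op_discontinuous:
  fixes \<tau> :: "(real^'n::finite \<Rightarrow> complex) topology"
  assumes E: "cfun_subspace (topspace \<tau>)"
    and sub: "\<And>m. m \<ge> 1 \<Longrightarrow> topspace \<tau> \<subseteq> (\<Union>n\<in>{1..}. O_space \<omega> m n)"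
    and cont: "\<And>m. m \<ge> 1 \<Longrightarrow> seminorm_continuous \<tau> (origin_norm m)"
    and waves: "small_waves i \<tau>"
  shows "discontinuous_map (prod_topology \<tau> (strong_dual \<tau>)) (strong_dual \<tau>) (mult_op \<tau>)"
proof -
  let ?E = "topspace \<tau>" and ?Z = "\<lambda>g\<in>topspace \<tau>. 0 :: complex"
  have dual: "topspace (strong_dual \<tau>) = dual \<tau>" by (simp add: strong_dual_def)
  have E0: "0 \<in> ?E" using cfun.subspace_0[OF E] .
  have one: "1 \<in> ?E" using tvs_bounded_one[OF waves] by (simp add: tvs_bounded_def)
  \<comment> \<open>The condition is \<open>cmod (T 1) < 1\<close>, written as a ball around the
    zero functional.\<close>
  define U where "U = {T \<in> dual \<tau>. (SUP g\<in>{1}. cmod ((T - ?Z) g)) < 1}"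
  have "\<exists>B. (\<lambda>T :: (real^'n \<Rightarrow> complex) \<Rightarrow> complex. SUP g\<in>{1}. cmod (T g)) = (\<lambda>T. SUP g\<in>B. cmod (T g))
      \<and> tvs_bounded \<tau> B \<and> B \<noteq> {}"
    using tvs_bounded_one[OF waves] by blast
  then have "openin (strong_dual \<tau>) U"
    unfolding U_def strong_dual_def seminorm_topology_def
    by (intro topology_generated_by_Basis insertI2 CollectI exI[of _ ?Z] exI[of _ "1::real"]
        exI[of _ "\<lambda>T. SUP g\<in>{1}. cmod (T g)"] conjI refl zero_in_dual[OF E] zero_less_one)
  moreover have "\<not> openin (prod_topology \<tau> (strong_dual \<tau>))
      {x \<in> topspace (prod_topology \<tau> (strong_dual \<tau>)). mult_op \<tau> x \<in> U}"
  proof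
    assume "openin (prod_topology \<tau> (strong_dual \<tau>))
      {x \<in> topspace (prod_topology \<tau> (strong_dual \<tau>)). mult_op \<tau> x \<in> U}"
    moreover have "mult_op \<tau> (0, ?Z) = ?Z" using E0 by (auto simp: mult_op_def)
    then have "(0, ?Z) \<in> {x \<in> topspace (prod_topology \<tau> (strong_dual \<tau>)). mult_op \<tau> x \<in> U}"
      using E0 zero_in_dual[OF E] one by (auto simp: dual U_def)
    ultimately obtain V W where V: "openin \<tau> V" "0 \<in> V" and W: "openin (strong_dual \<tau>) W" "?Z \<in> W"
      and VW: "V \<times> W \<subseteq> {x \<in> topspace (prod_topology \<tau> (strong_dual \<tau>)). mult_op \<tau> x \<in> U}"
      unfolding openin_prod_topology_alt by blast
    \<comment> \<open>The value of \<open>f T\<close> at the constant 1 is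
      \<open>T f\<close>.\<close>
    have small: "cmod (T f) < 1" if "f \<in> V" "T \<in> W" for f T
    proof -
      have "mult_op \<tau> (f, T) \<in> U" using VW that by blast
      moreover have "f * 1 = f" by (simp add: fun_eq_iff)
      ultimately show ?thesis using one by (simp add: U_def mult_op_def del: times_fun_def)
    qed
    obtain B \<delta> where B: "tvs_bounded \<tau> B" and \<delta>: "\<delta> > 0"
      and BW: "\<And>T. T \<in> dual \<tau> \<Longrightarrow> (\<And>g. g \<in> B \<Longrightarrow> cmod (T g) \<le> \<delta>) \<Longrightarrow> T \<in> W"
      using strong_dual_nhd_zero[OF W E0] by blast
    obtain m \<rho> where m: "m \<ge> 1" and \<rho>: "\<rho> > 0"
      and wV: "\<And>c s t. t \<ge> 0 \<Longrightarrow> \<bar>s\<bar> \<le> exp t \<Longrightarrow>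
        cmod c * exp (real m * \<omega> (exp t)) < \<rho> \<Longrightarrow> wave i c s \<in> V"
      using waves V unfolding small_waves_def contains_small_waves_def by blast
    \<comment> \<open>The bounds are collected in a positive function of all \<open>m'\<close>, with
      an arbitrary value at 0.\<close>
    have "\<forall>m'. \<exists>C>0. m' \<ge> 1 \<longrightarrow> (\<forall>g\<in>B. origin_norm m' g \<le> C)"
    proof
      fix m' :: nat
      show "\<exists>C>0. m' \<ge> 1 \<longrightarrow> (\<forall>g\<in>B. origin_norm m' g \<le> C)"
      proof (cases "m' \<ge> 1")
        case True
        from tvs_bounded_seminorm[OF B seminorm_on_origin_norm[OF True E sub[OF True]] order_refl
            cont[OF True] E0]
        show ?thesis by blast
      qed (use zero_less_one in blast)
    qed
    then obtain C where C: "\<And>m'. C m' > 0" "\<And>m' g. m' \<ge> 1 \<Longrightarrow> g \<in> B \<Longrightarrow> origin_norm m' g \<le> C m'"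
      by metis
    \<comment> \<open>This constant makes the value of \<open>T\<close> at the wave below at least
      1; the 2 compensates the half in \<open>c\<close>.\<close>
    have "2 * C m' / (\<delta> * \<rho>) > 0" for m' using C(1)[of m'] \<delta> \<rho> by simp
    from exp_not_dominated[OF m, of "\<lambda>m'. 2 * C m' / (\<delta> * \<rho>)", OF this] obtain k m' t where m': "m' \<ge> 1" and t: "t \<ge> 0"
      and pos: "decay m' 0 k > 0"
      and large: "2 * C m' / (\<delta> * \<rho>) \<le> decay m' 0 k * exp (real k * t - real m * \<omega> (exp t))"
      by blast
    define w where "w = decay m' 0 k"
    let ?\<alpha> = "(\<lambda>_. 0)(i := k)"
    \<comment> \<open>Normalised such that \<open>cmod (T g)\<close> is
      \<open>\<delta> / C m'\<close> times a weighted derivative, which is at most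
      \<open>C m'\<close> on \<open>B\<close>.\<close>
    define T where "T = (\<lambda>g\<in>?E. of_real (\<delta> * w / C m') * multi_deriv ?\<alpha> g 0)"
    \<comment> \<open>Half of the amplitude threshold in \<open>wV\<close>, whose inequality is
      strict.\<close>
    define c where "c = \<rho> / 2 * exp (- (real m * \<omega> (exp t)))"
    define f where "f = wave i (of_real c) (exp t)"
    have "c > 0" using \<rho> by (simp add: c_def)
    have "cmod (of_real c) * exp (real m * \<omega> (exp t)) = c * exp (real m * \<omega> (exp t))"
      unfolding norm_of_real using \<open>c > 0\<close> by simp
    also have "\<dots> = \<rho> / 2" by (simp add: c_def exp_minus)
    also have "\<dots> < \<rho>" using \<rho> by simp
    finally have "f \<in> V" unfolding f_def using t by (intro wV[OF t]) auto
    moreover have "T \<in> W"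
    proof (rule BW)
      show "T \<in> dual \<tau>" unfolding T_def by (rule derivative_in_dual[OF E sub cont])
      fix g assume g: "g \<in> B"
      then have gE: "g \<in> ?E" using B by (auto simp: tvs_bounded_def)
      then obtain n where n: "g \<in> O_space \<omega> m' n" using sub[OF m'] by blast
      have "cmod (T g) = \<delta> / C m' * cmod (weighted_deriv m' 0 ?\<alpha> 0 g)"
        using gE \<delta> C(1)[of m'] pos
        by (simp add: T_def cmod_weighted_deriv[OF m'] norm_mult norm_divide w_def)
      also have "\<dots> \<le> \<delta> / C m' * C m'"
        using \<delta> C(1)[of m'] order_trans[OF origin_norm_ge[OF m' n] C(2)[OF m' g]]
        by (intro mult_left_mono) auto
      also have "\<dots> = \<delta>" using C(1)[of m'] by simp
      finally show "cmod (T g) \<le> \<delta>" .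
    qed
    ultimately have "cmod (T f) < 1" by (rule small)
    moreover have "cmod (T f) = \<delta> * w / C m' * (c * exp (real k * t))"
    proof -
      have "f \<in> ?E" using \<open>f \<in> V\<close> openin_subset[OF V(1)] by blast
      then show ?thesis
        using \<delta> C(1)[of m'] pos \<open>c > 0\<close>
        by (simp add: T_def f_def norm_mult norm_divide cmod_multi_deriv_wave_eq w_def del: of_real_exp)
    qed
    \<comment> \<open>The value splits into the quantity bounded below in \<open>large\<close> and
      the reciprocal of that bound.\<close>
    moreover have "\<delta> * w / C m' * (c * exp (real k * t))
        = (w * exp (real k * t - real m * \<omega> (exp t))) * (\<delta> * \<rho> / (2 * C m'))"
      by (simp add: c_def exp_diff exp_minus field_simps)
    moreover have "2 * C m' / (\<delta> * \<rho>) * (\<delta> * \<rho> / (2 * C m'))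
        \<le> (w * exp (real k * t - real m * \<omega> (exp t))) * (\<delta> * \<rho> / (2 * C m'))"
      using large \<delta> \<rho> C(1)[of m'] unfolding w_def by (intro mult_right_mono) auto
    moreover have "2 * C m' / (\<delta> * \<rho>) * (\<delta> * \<rho> / (2 * C m')) = 1"
      using \<delta> \<rho> C(1)[of m'] by simp
    ultimately show False by linarith
  qed
  ultimately show ?thesis unfolding discontinuous_map_def by blast
qed

section \<open>Application to the two spaces\<close>

lemma mult_op_O_M_discontinuous:
  "discontinuous_map (prod_topology (O_M \<omega> :: (real^'n::finite \<Rightarrow> complex) topology) (strong_dual (O_M \<omega>)))
    (strong_dual (O_M \<omega>)) (mult_op (O_M \<omega>))"
proof (rule mult_op_discontinuous)
  have sub: "cfun_subspace (\<Union>n\<in>{1..}. O_space \<omega> m n :: (real^'n \<Rightarrow> complex) set)" if "m \<ge> 1" for m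
    using that by (intro subspace_UN_mono O_space_subspace O_space_mono)
  show "cfun_subspace (topspace (O_M \<omega> :: (real^'n \<Rightarrow> complex) topology))"
    unfolding topspace_O_M by (intro cfun.subspace_Inter) (use sub in auto)
  fix m :: nat assume m: "m \<ge> 1"
  then show "topspace (O_M \<omega> :: (real^'n \<Rightarrow> complex) topology) \<subseteq> (\<Union>n\<in>{1..}. O_space \<omega> m n)"
    unfolding topspace_O_M by blast
  have "seminorm_on (\<Union>n\<in>{1..}. topspace (O_top \<omega> m n :: (real^'n \<Rightarrow> complex) topology)) (origin_norm m)"
    unfolding topspace_O_top by (rule seminorm_on_origin_norm[OF m sub[OF m] order_refl])
  \<comment> \<open>The \<open>m\<close>-th factor of the projective limit is enough, and
    \<open>origin_norm m\<close> is the same seminorm on all its steps.\<close>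
  then show "seminorm_continuous (O_M \<omega> :: (real^'n \<Rightarrow> complex) topology) (origin_norm m)"
    unfolding O_M_def
    by (intro seminorm_continuous_proj_limit[of m] seminorm_continuous_ind_limit
        seminorm_continuous_O_top m) (use m in auto)
next
  show "small_waves i (O_M \<omega>)" for i :: 'n
    unfolding O_M_def
    by (intro small_waves_proj_limit small_waves_ind_limit[of 1] small_waves_O_top) auto
qed

lemma mult_op_O_C_discontinuous:
  "discontinuous_map (prod_topology (O_C \<omega> :: (real^'n::finite \<Rightarrow> complex) topology) (strong_dual (O_C \<omega>)))
    (strong_dual (O_C \<omega>)) (mult_op (O_C \<omega>))"
proof (rule mult_op_discontinuous)
  have "(\<Inter>m\<in>{1..}. O_space \<omega> m n :: (real^'n \<Rightarrow> complex) set) \<subseteq> (\<Inter>m\<in>{1..}. O_space \<omega> m n')"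
    if "n \<le> n'" for n n'
    by (rule INF_superset_mono) (use O_space_mono[OF _ that] in auto)
  moreover have "cfun_subspace (\<Inter>m\<in>{1..}. O_space \<omega> m n :: (real^'n \<Rightarrow> complex) set)" for n
    by (intro cfun.subspace_Inter) (use O_space_subspace in auto)
  ultimately have sub: "cfun_subspace (\<Union>n\<in>{1..}. \<Inter>m\<in>{1..}. O_space \<omega> m n :: (real^'n \<Rightarrow> complex) set)"
    by (intro subspace_UN_mono)
  then show "cfun_subspace (topspace (O_C \<omega> :: (real^'n \<Rightarrow> complex) topology))"
    unfolding topspace_O_C .
  fix m :: nat assume m: "m \<ge> 1"
  then show le: "topspace (O_C \<omega> :: (real^'n \<Rightarrow> complex) topology) \<subseteq> (\<Union>n\<in>{1..}. O_space \<omega> m n)"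
    unfolding topspace_O_C by blast
  have "topspace (proj_limit {1..} (\<lambda>m. O_top \<omega> m n))
      = (\<Inter>m\<in>{1..}. O_space \<omega> m n :: (real^'n \<Rightarrow> complex) set)" for n
    by (subst topspace_proj_limit) (auto simp: topspace_O_top)
  then have "seminorm_on (\<Union>n\<in>{1..}. topspace (proj_limit {1..} (\<lambda>m. O_top \<omega> m n)
      :: (real^'n \<Rightarrow> complex) topology)) (origin_norm m)"
    using seminorm_on_origin_norm[OF m sub] le unfolding topspace_O_C by simp
  \<comment> \<open>The limits are nested the other way round: the seminorm is continuous on each
    projective limit through its \<open>m\<close>-th factor, and therefore on the inductive
    limit.\<close>
  then show "seminorm_continuous (O_C \<omega> :: (real^'n \<Rightarrow> complex) topology) (origin_norm m)"
    unfolding O_C_def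
    by (intro seminorm_continuous_ind_limit seminorm_continuous_proj_limit[of m]
        seminorm_continuous_O_top m) (use m in auto)
next
  show "small_waves i (O_C \<omega>)" for i :: 'n
    unfolding O_C_def
    by (intro small_waves_ind_limit[of 1] small_waves_proj_limit small_waves_O_top) auto
qed

end

theorem proposition4p7:
  fixes \<omega> :: "real \<Rightarrow> real"
  assumes "nonquasianalytic_weight \<omega>"
  shows "discontinuous_map
           (prod_topology (O_M \<omega> :: (real^'n::finite \<Rightarrow> complex) topology) (strong_dual (O_M \<omega>)))
           (strong_dual (O_M \<omega>)) (mult_op (O_M \<omega>)) \<and>
         discontinuous_map
           (prod_topology (O_C \<omega> :: (real^'n::finite \<Rightarrow> complex) topology) (strong_dual (O_C \<omega>)))
           (strong_dual (O_C \<omega>)) (mult_op (O_C \<omega>))"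
proof -
  interpret weight \<omega> by unfold_locales (fact assms)
  show ?thesis using mult_op_O_M_discontinuous mult_op_O_C_discontinuous by blast
qed

end
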